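(* Let $X$ be a smooth manifold, possibly with boundary, with interior $X^\circ$, endowed with a fixed positive smooth density $d\mu$. Let $E\subset L^2(X)$ be a closed (complex) linear subspace with $\dim E\ge 2$. Then there exists $\sigma\in C_c^\infty(X^\circ,\mathbb R)$ such that, for every $c\in\mathbb R$, $$G_\sigma:=(P_E M_\sigma)|_E:E\to E\quad\text{satisfies}\quad G_\sigma\neq c\,I_E .$$
   Context: $L^2(X):=L^2(X,\mathbb C;d\mu)$. $M_\sigma$ is multiplication by $\sigma$ on $L^2(X)$ and $P_E$ is the orthogonal projection of $L^2(X)$ onto $E$. *)

theory Defs
  imports "HOL-Analysis.Analysis"
begin

section \<open>Smooth maps between Euclidean spaces\<close>

primrec Ck_on :: "nat \<Rightarrow> ('b::real_normed_vector \<Rightarrow> 'c::real_normed_vector) \<Rightarrow> 'b set \<Rightarrow> bool" where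
  "Ck_on 0 f U \<longleftrightarrow> continuous_on U f"
| "Ck_on (Suc k) f U \<longleftrightarrow>
     (\<forall>x\<in>U. f differentiable (at x)) \<and> (\<forall>v. Ck_on k (\<lambda>x. frechet_derivative f (at x) v) U)"

text \<open>On a set that need not be open (such as an open piece of a half-space), smoothness means
  having, near each point of the set, a smooth extension to an open subset of the ambient space.
  \<^const>\<open>Ck_on\<close> is only meant to be used on open sets.\<close>

definition smooth_on :: "('b::real_normed_vector \<Rightarrow> 'c::real_normed_vector) \<Rightarrow> 'b set \<Rightarrow> bool" where
  "smooth_on f S \<longleftrightarrow>
     (\<forall>x\<in>S. \<exists>W g. open W \<and> x \<in> W \<and> (\<forall>k. Ck_on k g W) \<and> (\<forall>y\<in>S \<inter> W. g y = f y))"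


section \<open>Smooth manifolds with boundary\<close>

text \<open>The space $\mathbb R^n$ is modelled as the span of a set \<open>B\<close> of \<open>n\<close> standard basis vectors of a
  Euclidean space type. The choice \<open>B = Basis\<close> gives the type itself; the choice \<open>B = {}\<close> covers
  dimension 0, which no Euclidean space type has.

  A chart is a pair of its domain and its coordinate map (only the values on the domain matter).
  As usual for manifolds with boundary, its image is open in $\mathbb R^n$ or in a coordinate
  half-space. A manifold is a type \<open>'a\<close> whose topology is Hausdorff and second countable,
  together with a smooth atlas.\<close>

type_synonym ('a, 'b) chart = "'a set \<times> ('a \<Rightarrow> 'b)"

definition is_chart :: "'b::euclidean_space set \<Rightarrow> ('a::topological_space, 'b) chart \<Rightarrow> bool" where
  "is_chart B = (\<lambda>(U, \<phi>).
     open U \<and> homeomorphism U (\<phi> ` U) \<phi> (inv_into U \<phi>) \<and>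
     (openin (top_of_set (span B)) (\<phi> ` U) \<or>
      (\<exists>b\<in>B. openin (top_of_set {x \<in> span B. 0 \<le> x \<bullet> b}) (\<phi> ` U))))"

definition smooth_atlas ::
  "'b::euclidean_space set \<Rightarrow> ('a::{t2_space, second_countable_topology}, 'b) chart set \<Rightarrow> bool" where
  "smooth_atlas B \<A> \<longleftrightarrow>
     B \<subseteq> Basis \<and>
     (\<forall>c\<in>\<A>. is_chart B c) \<and>
     (\<Union>(U, \<phi>)\<in>\<A>. U) = UNIV \<and>
     (\<forall>(U, \<phi>)\<in>\<A>. \<forall>(V, \<psi>)\<in>\<A>. smooth_on (\<psi> \<circ> inv_into U \<phi>) (\<phi> ` (U \<inter> V)))"

text \<open>A point is interior if some chart sends it to a point around which the image of the chart is
  open in $\mathbb R^n$ (and not merely in a half-space).\<close>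

definition manifold_interior ::
  "'b::euclidean_space set \<Rightarrow> ('a::topological_space, 'b) chart set \<Rightarrow> 'a set" where
  "manifold_interior B \<A> =
     {p. \<exists>(U, \<phi>)\<in>\<A>. p \<in> U \<and> \<phi> p \<in> top_of_set (span B) interior_of (\<phi> ` U)}"

definition smooth_function ::
  "('a::topological_space, 'b::euclidean_space) chart set \<Rightarrow> ('a \<Rightarrow> real) \<Rightarrow> bool" where
  "smooth_function \<A> f \<longleftrightarrow> (\<forall>(U, \<phi>)\<in>\<A>. smooth_on (f \<circ> inv_into U \<phi>) (\<phi> ` U))"

text \<open>Elements of $C_c^\infty(X^\circ,\mathbb R)$, extended by zero to all of $X$.\<close>

definition Cc_infinity_interior ::
  "'b::euclidean_space set \<Rightarrow> ('a::topological_space, 'b) chart set \<Rightarrow> ('a \<Rightarrow> real) set" where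
  "Cc_infinity_interior B \<A> =
     {f. smooth_function \<A> f \<and> compact (closure {p. f p \<noteq> 0}) \<and>
         closure {p. f p \<noteq> 0} \<subseteq> manifold_interior B \<A>}"


section \<open>Smooth positive densities\<close>

text \<open>Lebesgue measure of \<open>span B\<close>, as a measure on the ambient space; a unit point mass at 0 if
  \<open>B = {}\<close>.\<close>

definition lborel_span :: "'b::euclidean_space set \<Rightarrow> 'b measure" where
  "lborel_span B = distr (\<Pi>\<^sub>M b\<in>B. lborel) borel (\<lambda>x. \<Sum>b\<in>B. x b *\<^sub>R b)"

lemma lborel_span_Basis: "lborel_span Basis = lborel"
  by (simp add: lborel_span_def lborel_eq [symmetric])

text \<open>A positive smooth density is identified with its measure: the Borel measures which in every
  chart are a positive smooth function \<open>\<rho>\<close> times Lebesgue measure. The usual transformation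
  rule of \<open>\<rho>\<close> by the absolute value of the Jacobian determinant is then automatic.\<close>

definition positive_smooth_density ::
  "'b::euclidean_space set \<Rightarrow> ('a::topological_space, 'b) chart set \<Rightarrow> 'a measure \<Rightarrow> bool" where
  "positive_smooth_density B \<A> M \<longleftrightarrow>
     sets M = sets borel \<and>
     (\<forall>(U, \<phi>)\<in>\<A>. \<exists>\<rho>::'b \<Rightarrow> real. smooth_on \<rho> (\<phi> ` U) \<and> (\<forall>y\<in>\<phi> ` U. 0 < \<rho> y) \<and>
        (\<forall>S\<in>sets borel. S \<subseteq> U \<longrightarrow>
           emeasure M S = (\<integral>\<^sup>+y\<in>\<phi> ` S. ennreal (\<rho> y) \<partial>lborel_span B)))"


section \<open>The Hilbert space of square-integrable complex functions\<close>

definition square_integrable :: "'a measure \<Rightarrow> ('a \<Rightarrow> complex) set" where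
  "square_integrable M = {f \<in> borel_measurable M. integrable M (\<lambda>x. (cmod (f x))\<^sup>2)}"

definition ae_rel :: "'a measure \<Rightarrow> (('a \<Rightarrow> complex) \<times> ('a \<Rightarrow> complex)) set" where
  "ae_rel M = {(f, g). f \<in> square_integrable M \<and> g \<in> square_integrable M \<and> (AE x in M. f x = g x)}"

text \<open>Elements of \<open>L2 M\<close> are almost-everywhere classes; all operations are defined on
  representatives and do not depend on their choice.\<close>

type_synonym 'a L2_class = "('a \<Rightarrow> complex) set"

definition L2 :: "'a measure \<Rightarrow> 'a L2_class set" where
  "L2 M = square_integrable M // ae_rel M"

definition L2_cls :: "'a measure \<Rightarrow> ('a \<Rightarrow> complex) \<Rightarrow> 'a L2_class" where
  "L2_cls M f = ae_rel M `` {f}"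

definition L2_rep :: "'a L2_class \<Rightarrow> 'a \<Rightarrow> complex" where
  "L2_rep F = (SOME f. f \<in> F)"

definition L2_zero :: "'a measure \<Rightarrow> 'a L2_class" where
  "L2_zero M = L2_cls M (\<lambda>x. 0)"

definition L2_add :: "'a measure \<Rightarrow> 'a L2_class \<Rightarrow> 'a L2_class \<Rightarrow> 'a L2_class" where
  "L2_add M F G = L2_cls M (\<lambda>x. L2_rep F x + L2_rep G x)"

definition L2_diff :: "'a measure \<Rightarrow> 'a L2_class \<Rightarrow> 'a L2_class \<Rightarrow> 'a L2_class" where
  "L2_diff M F G = L2_cls M (\<lambda>x. L2_rep F x - L2_rep G x)"

definition L2_scale :: "'a measure \<Rightarrow> complex \<Rightarrow> 'a L2_class \<Rightarrow> 'a L2_class" where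
  "L2_scale M c F = L2_cls M (\<lambda>x. c * L2_rep F x)"

definition L2_inner :: "'a measure \<Rightarrow> 'a L2_class \<Rightarrow> 'a L2_class \<Rightarrow> complex" where
  "L2_inner M F G = (\<integral>x. L2_rep F x * cnj (L2_rep G x) \<partial>M)"

definition L2_dist :: "'a measure \<Rightarrow> 'a L2_class \<Rightarrow> 'a L2_class \<Rightarrow> real" where
  "L2_dist M F G = sqrt (\<integral>x. (cmod (L2_rep F x - L2_rep G x))\<^sup>2 \<partial>M)"

definition L2_subspace :: "'a measure \<Rightarrow> 'a L2_class set \<Rightarrow> bool" where
  "L2_subspace M E \<longleftrightarrow>
     E \<subseteq> L2 M \<and> L2_zero M \<in> E \<and>
     (\<forall>F\<in>E. \<forall>G\<in>E. L2_add M F G \<in> E) \<and> (\<forall>c. \<forall>F\<in>E. L2_scale M c F \<in> E)"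

definition L2_closed :: "'a measure \<Rightarrow> 'a L2_class set \<Rightarrow> bool" where
  "L2_closed M E \<longleftrightarrow> closedin (Metric_space.mtopology (L2 M) (L2_dist M)) E"

text \<open>Complex dimension at least \<open>n\<close> (infinite dimension included): there are \<open>n\<close> linearly
  independent elements.\<close>

definition L2_lincomb :: "'a measure \<Rightarrow> nat \<Rightarrow> (nat \<Rightarrow> complex) \<Rightarrow> (nat \<Rightarrow> 'a L2_class) \<Rightarrow> 'a L2_class" where
  "L2_lincomb M n a F = L2_cls M (\<lambda>x. \<Sum>i<n. a i * L2_rep (F i) x)"

definition L2_dim_ge :: "'a measure \<Rightarrow> nat \<Rightarrow> 'a L2_class set \<Rightarrow> bool" where
  "L2_dim_ge M n E \<longleftrightarrow>
     (\<exists>F. (\<forall>i<n. F i \<in> E) \<and> (\<forall>a. L2_lincomb M n a F = L2_zero M \<longrightarrow> (\<forall>i<n. a i = 0)))"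


section \<open>Multiplication operators, orthogonal projections, compressions\<close>

definition L2_mult :: "'a measure \<Rightarrow> ('a \<Rightarrow> real) \<Rightarrow> 'a L2_class \<Rightarrow> 'a L2_class" where
  "L2_mult M \<sigma> F = L2_cls M (\<lambda>x. complex_of_real (\<sigma> x) * L2_rep F x)"

definition L2_proj :: "'a measure \<Rightarrow> 'a L2_class set \<Rightarrow> 'a L2_class \<Rightarrow> 'a L2_class" where
  "L2_proj M E F = (THE P. P \<in> E \<and> (\<forall>G\<in>E. L2_inner M (L2_diff M F P) G = 0))"

definition compression :: "'a measure \<Rightarrow> 'a L2_class set \<Rightarrow> ('a \<Rightarrow> real) \<Rightarrow> 'a L2_class \<Rightarrow> 'a L2_class" where
  "compression M E \<sigma> = (\<lambda>F\<in>E. L2_proj M E (L2_mult M \<sigma> F))"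

end

(* If every compression G_sigma were a multiple of the identity, then for orthogonal nonzero f, g in E
   the functions f * cnj g and norm(g)^2 * |f|^2 - norm(f)^2 * |g|^2 would integrate to 0 against
   every test function sigma. By the fundamental lemma of the calculus of variations (the boundary is
   a null set) both vanish almost everywhere, which forces f = g = 0. That G_sigma maps E to E at all
   is the projection theorem, which rests on the completeness of L2. *)

theory Submission
  imports Defs "HOL-Computational_Algebra.Polynomial"
begin

section \<open>Calculus of smooth functions\<close>

text \<open>The scalar \<open>c\<close> may change with \<open>\<sigma>\<close>, so both integrands
  are chosen to make it cancel: orthogonality of f and g does so for f * cnj g, and the weights
  norm(g)^2 and norm(f)^2 do so for the difference of squares. Pointwise, the first identity says
  that f or g vanishes; the second, whose weights are positive, then makes the other one vanish too.
  In a one-dimensional E there is no such pair, and every compression is a scalar.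

  The main work is to supply enough test functions. The integrand is merely integrable, so the aim
  is to write the indicator of an open set as a pointwise limit of test functions with values
  between 0 and 1. Bumps are made inside one chart, countably many cover the open set, and composing
  growing multiples of their partial sums with exp(-1/x) preserves smoothness and compact support. A
  pi-lambda argument passes from open to Borel sets.

  On the Hilbert space side, everything is computed with functions instead of almost-everywhere
  classes, and a compression enters only through its inner products with elements of E.\<close>

lemma Ck_on_cong:
  assumes "open U" "\<And>x. x \<in> U \<Longrightarrow> f x = g x" "Ck_on k f U"
  shows "Ck_on k g U"
  using assms(2,3)
proof (induction k arbitrary: f g)
  case 0
  then show ?case
    using continuous_on_cong[of U U f g] by simp
next
  case (Suc k)
  have der: "(g has_derivative frechet_derivative f (at x)) (at x)" if "x \<in> U" for x
    using has_derivative_transform_within_open[OF _ assms(1) that, of f _ UNIV g] Suc.prems that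
    by (simp add: frechet_derivative_works)
  then have eq: "frechet_derivative g (at x) = frechet_derivative f (at x)" if "x \<in> U" for x
    using frechet_derivative_at that by metis
  show ?case
    using Suc.IH[of "\<lambda>x. frechet_derivative f (at x) v" "\<lambda>x. frechet_derivative g (at x) v" for v]
      Suc.prems(2) eq der by (auto simp: differentiable_def)
qed

lemma Ck_on_subset: "Ck_on k f U \<Longrightarrow> V \<subseteq> U \<Longrightarrow> Ck_on k f V"
proof (induction k arbitrary: f)
  case 0
  then show ?case using continuous_on_subset by auto
qed auto

text \<open>Derivatives are unique at points of an open set, so any explicit derivative may replace
  the choice made by \<open>frechet_derivative\<close>. The closure rules below use this
  form.\<close>

lemma Ck_on_SucI:
  assumes "open U"
    and "\<And>x. x \<in> U \<Longrightarrow> (f has_derivative f' x) (at x)"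
    and "\<And>v. Ck_on k (\<lambda>x. f' x v) U"
  shows "Ck_on (Suc k) f U"
proof -
  have eq: "f' x = frechet_derivative f (at x)" if "x \<in> U" for x
    using frechet_derivative_at assms(2) that by blast
  have "Ck_on k (\<lambda>x. frechet_derivative f (at x) v) U" for v
    by (rule Ck_on_cong[OF assms(1) _ assms(3)[of v]]) (simp add: eq)
  then show ?thesis
    using assms(2) by (auto simp: differentiable_def)
qed

lemma Ck_on_Suc_has_derivative:
  "Ck_on (Suc k) f U \<Longrightarrow> x \<in> U \<Longrightarrow> (f has_derivative frechet_derivative f (at x)) (at x)"
  by (simp add: frechet_derivative_works)

text \<open>The product and chain rules at order \<open>Suc k\<close> also contain undifferentiated
  functions, which are needed at order \<open>k\<close>. The recursion passes to derivatives, so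
  only "differentiable implies continuous" is left at the bottom.\<close>

lemma Ck_on_Suc_imp:
  assumes "open U" "Ck_on (Suc k) f U"
  shows "Ck_on k f U"
  using assms(2)
proof (induction k arbitrary: f)
  case 0
  then show ?case
    by (auto intro!: continuous_at_imp_continuous_on differentiable_imp_continuous_within)
qed auto

lemma Ck_on_const: "open U \<Longrightarrow> Ck_on k (\<lambda>x. c) U"
  by (induction k arbitrary: c) (auto simp: frechet_derivative_const)

lemma Ck_on_add:
  assumes "open U" "Ck_on k f U" "Ck_on k g U"
  shows "Ck_on k (\<lambda>x. f x + g x) U"
  using assms(2,3)
proof (induction k arbitrary: f g)
  case 0
  then show ?case by (auto intro: continuous_intros)
next
  case (Suc k)
  show ?case
    by (rule Ck_on_SucI[OF assms(1), where f' = "\<lambda>x v. frechet_derivative f (at x) v + frechet_derivative g (at x) v"])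
      (use Suc in \<open>auto intro!: derivative_intros simp: frechet_derivative_works\<close>)
qed

lemma Ck_on_sum:
  assumes "open U" "\<And>i. i \<in> I \<Longrightarrow> Ck_on k (f i) U"
  shows "Ck_on k (\<lambda>x. \<Sum>i\<in>I. f i x) U"
  using assms(2)
  by (induction I rule: infinite_finite_induct) (auto intro: Ck_on_const Ck_on_add assms(1))

lemma Ck_on_bounded_linear:
  assumes "open U" "bounded_linear L" "Ck_on k f U"
  shows "Ck_on k (\<lambda>x. L (f x)) U"
  using assms(3)
proof (induction k arbitrary: f)
  case 0
  then show ?case
    using bounded_linear.continuous_on[OF assms(2)] by auto
next
  case (Suc k)
  show ?case
    by (rule Ck_on_SucI[OF assms(1), where f' = "\<lambda>x v. L (frechet_derivative f (at x) v)"])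
      (use Suc in \<open>auto intro!: bounded_linear.has_derivative[OF assms(2)] simp: frechet_derivative_works\<close>)
qed

lemma Ck_on_mult:
  fixes f g :: "'b::real_normed_vector \<Rightarrow> real"
  assumes "open U" "Ck_on k f U" "Ck_on k g U"
  shows "Ck_on k (\<lambda>x. f x * g x) U"
  using assms(2,3)
proof (induction k arbitrary: f g)
  case 0
  then show ?case by (auto intro: continuous_intros)
next
  case (Suc k)
  show ?case
  proof (rule Ck_on_SucI[OF assms(1)])
    show "((\<lambda>x. f x * g x) has_derivative
        (\<lambda>v. f x * frechet_derivative g (at x) v + frechet_derivative f (at x) v * g x)) (at x)"
      if "x \<in> U" for x
      using Suc.prems that by (intro has_derivative_mult Ck_on_Suc_has_derivative)
    show "Ck_on k (\<lambda>x. f x * frechet_derivative g (at x) v + frechet_derivative f (at x) v * g x) U" for v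
      using Suc.prems Ck_on_Suc_imp[OF assms(1) Suc.prems(1)] Ck_on_Suc_imp[OF assms(1) Suc.prems(2)]
      by (intro Ck_on_add Suc.IH assms(1)) auto
  qed
qed

lemma Ck_on_compose_real:
  fixes f :: "real \<Rightarrow> real" and g :: "'b::real_normed_vector \<Rightarrow> real"
  assumes "open U" "Ck_on k f UNIV" "Ck_on k g U"
  shows "Ck_on k (\<lambda>x. f (g x)) U"
  using assms(2,3)
proof (induction k arbitrary: f g)
  case 0
  then show ?case using continuous_on_compose2[of UNIV f U g] by auto
next
  case (Suc k)
  show ?case
  proof (rule Ck_on_SucI[OF assms(1)])
    show "((\<lambda>x. f (g x)) has_derivative
        (\<lambda>v. frechet_derivative f (at (g x)) 1 * frechet_derivative g (at x) v)) (at x)"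
      if "x \<in> U" for x
    proof -
      have f: "(f has_derivative frechet_derivative f (at (g x))) (at (g x))"
        by (rule Ck_on_Suc_has_derivative[OF Suc.prems(1)]) simp
      have "linear (frechet_derivative f (at (g x)))"
        using f has_derivative_linear by blast
      \<comment> \<open>A linear map on the reals is multiplication by its value at 1; this turns
        the chain rule into a product of real functions, to which \<open>Ck_on_mult\<close>
        applies.\<close>
      then have "frechet_derivative f (at (g x)) w = frechet_derivative f (at (g x)) 1 * w" for w
        using linear_scale[of "frechet_derivative f (at (g x))" w 1] by simp
      then show ?thesis
        by (intro has_derivative_eq_rhs[OF has_derivative_compose[OF Ck_on_Suc_has_derivative[OF Suc.prems(2) that] f]] ext)
    qed
    show "Ck_on k (\<lambda>x. frechet_derivative f (at (g x)) 1 * frechet_derivative g (at x) v) U" for v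
      using Suc.prems Ck_on_Suc_imp[OF assms(1) Suc.prems(2)]
      by (intro Ck_on_mult assms(1) Suc.IH[of "\<lambda>y. frechet_derivative f (at y) 1"]) auto
  qed
qed

text \<open>In coordinates this is a sum of squares of bounded linear images of \<open>g\<close>,
  hence smooth even where \<open>g\<close> vanishes, unlike the norm itself.\<close>

lemma Ck_on_norm_square:
  fixes g :: "'b::real_normed_vector \<Rightarrow> 'c::euclidean_space"
  assumes "open U" "Ck_on k g U"
  shows "Ck_on k (\<lambda>x. (norm (g x))\<^sup>2) U"
proof -
  have "Ck_on k (\<lambda>x. \<Sum>i\<in>Basis. (g x \<bullet> i) * (g x \<bullet> i)) U"
    by (intro Ck_on_sum Ck_on_mult assms(1) Ck_on_bounded_linear[OF assms(1) bounded_linear_inner_left assms(2)])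
  then show ?thesis
    by (rule Ck_on_cong[OF assms(1), rotated]) (simp only: power2_norm_eq_inner, rule euclidean_inner[symmetric])
qed

lemma Ck_on_scale_real: "open U \<Longrightarrow> Ck_on k (f :: _ \<Rightarrow> real) U \<Longrightarrow> Ck_on k (\<lambda>x. c * f x) U"
  using Ck_on_bounded_linear[OF _ bounded_linear_mult_right] .

text \<open>Functions of this form are closed under differentiation, and \<open>p = 1\<close> gives the smooth step.\<close>

definition poly_exp :: "real poly \<Rightarrow> real \<Rightarrow> real" where
  "poly_exp p x = (if x > 0 then poly p (1 / x) * exp (- (1 / x)) else 0)"

lemma poly_over_exp_tendsto_0:
  fixes p :: "real poly"
  shows "((\<lambda>t. poly p t * exp (- t)) \<longlongrightarrow> 0) at_top"
proof -
  have "((\<lambda>t::real. \<Sum>i\<le>degree p. coeff p i * (t ^ i / exp t)) \<longlongrightarrow> (\<Sum>i\<le>degree p. coeff p i * 0)) at_top"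
    by (intro tendsto_intros tendsto_power_div_exp_0)
  then show ?thesis
    by (simp add: poly_altdef sum_distrib_right exp_minus divide_inverse mult.assoc)
qed

text \<open>Put t = 1/x. The inner derivative is -t^2, which explains \<open>monom 1 2\<close>, and
  its sign turns p' - p into \<open>p - pderiv p\<close>. Only x = 0 needs a limit argument.\<close>

lemma DERIV_poly_exp:
  "(poly_exp p has_field_derivative poly_exp (monom 1 2 * (p - pderiv p)) x) (at x)"
proof -
  consider "x > 0" | "x < 0" | "x = 0" by linarith
  then show ?thesis
  proof cases
    case 1
    have inv: "((\<lambda>x. 1 / x) has_field_derivative - (1 / x\<^sup>2)) (at x)"
      using 1 by (auto intro!: derivative_eq_intros simp: power2_eq_square)
    have "((\<lambda>x. poly p (1 / x) * exp (- (1 / x))) has_field_derivative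
        poly p (1 / x) * (exp (- (1 / x)) * (1 / x\<^sup>2)) + poly (pderiv p) (1 / x) * - (1 / x\<^sup>2) * exp (- (1 / x))) (at x)"
      using DERIV_mult'[OF DERIV_chain2[OF poly_DERIV inv] DERIV_chain2[OF DERIV_exp DERIV_minus[OF inv]]]
      by simp
    also have "poly p (1 / x) * (exp (- (1 / x)) * (1 / x\<^sup>2)) + poly (pderiv p) (1 / x) * - (1 / x\<^sup>2) * exp (- (1 / x))
        = poly_exp (monom 1 2 * (p - pderiv p)) x"
      using 1 by (simp add: poly_exp_def poly_monom power_divide) (simp add: field_simps)
    finally have "((\<lambda>x. poly p (1 / x) * exp (- (1 / x))) has_field_derivative
        poly_exp (monom 1 2 * (p - pderiv p)) x) (at x)" .
    then show ?thesis
      by (rule has_field_derivative_transform_within_open[where S = "{0<..}"])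
        (use 1 in \<open>auto simp: poly_exp_def\<close>)
  next
    case 2
    have "((\<lambda>x. 0) has_field_derivative poly_exp (monom 1 2 * (p - pderiv p)) x) (at x)"
      using 2 by (simp add: poly_exp_def)
    then show ?thesis
      by (rule has_field_derivative_transform_within_open[where S = "{..<0}"])
        (use 2 in \<open>auto simp: poly_exp_def\<close>)
  next
    case 3
    \<comment> \<open>\<open>pCons 0 p\<close> is \<open>p\<close> times the variable; evaluated at
      1/h, the extra factor is the division by h in the difference quotient.\<close>
    have "((\<lambda>h. poly (pCons 0 p) (inverse h) * exp (- inverse h)) \<longlongrightarrow> 0) (at_right (0::real))"
      using poly_over_exp_tendsto_0[of "pCons 0 p"]
      unfolding filterlim_at_top_to_right .
    then have R: "((\<lambda>h. poly_exp p h / h) \<longlongrightarrow> 0) (at_right 0)"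
      by (rule Lim_transform_eventually)
        (simp add: eventually_at_filter poly_exp_def divide_inverse)
    have L: "((\<lambda>h. poly_exp p h / h) \<longlongrightarrow> 0) (at_left 0)"
      by (rule Lim_transform_eventually[OF tendsto_const])
        (auto simp: eventually_at_filter poly_exp_def)
    have "((\<lambda>h. poly_exp p h / h) \<longlongrightarrow> 0) (at 0)"
      by (rule filterlim_split_at[OF L R])
    then show ?thesis
      using 3 by (simp add: DERIV_def poly_exp_def)
  qed
qed

lemma Ck_on_poly_exp: "Ck_on k (poly_exp p) UNIV"
proof (induction k arbitrary: p)
  case 0
  then show ?case
    using DERIV_isCont[OF DERIV_poly_exp] by (simp add: continuous_at_imp_continuous_on)
next
  case (Suc k)
  show ?case
  proof (rule Ck_on_SucI)
    show "(poly_exp p has_derivative (\<lambda>v. poly_exp (monom 1 2 * (p - pderiv p)) x * v)) (at x)" for x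
      using DERIV_poly_exp[of p x] by (simp only: has_field_derivative_def)
    have "(\<lambda>x. poly_exp q x * v) = poly_exp (smult v q)" for q v
      by (auto simp: poly_exp_def)
    then show "Ck_on k (\<lambda>x. poly_exp (monom 1 2 * (p - pderiv p)) x * v) UNIV" for v
      using Suc by (simp only:)
  qed simp
qed

definition plateau :: "real \<Rightarrow> real" where
  "plateau x = (if x > 0 then exp (- (1 / x)) else 0)"

lemma Ck_on_plateau: "Ck_on k plateau UNIV"
proof -
  have "plateau = poly_exp 1"
    by (rule ext) (simp add: plateau_def poly_exp_def)
  then show ?thesis
    by (metis Ck_on_poly_exp)
qed

lemma plateau_pos_iff: "0 < plateau x \<longleftrightarrow> 0 < x"
  and plateau_eq_0_iff: "plateau x = 0 \<longleftrightarrow> x \<le> 0"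
  and plateau_nonneg: "0 \<le> plateau x"
  and plateau_le_1: "plateau x \<le> 1"
  by (auto simp: plateau_def)

lemma plateau_tendsto_1: "(plateau \<longlongrightarrow> 1) at_top"
proof -
  have "((\<lambda>x::real. exp (- (1 / x))) \<longlongrightarrow> exp (- 0)) at_top"
    by (intro tendsto_intros tendsto_divide_0[OF tendsto_const] filterlim_at_top_imp_at_infinity filterlim_ident)
  moreover have "\<forall>\<^sub>F x in at_top. exp (- (1 / x)) = plateau x"
    using eventually_gt_at_top[of 0] by eventually_elim (simp add: plateau_def)
  ultimately show ?thesis
    by (simp add: Lim_transform_eventually)
qed

section \<open>Test functions on a manifold\<close>

lemma smooth_onE:
  assumes "smooth_on f S" "x \<in> S"
  obtains W g where "open W" "x \<in> W" "\<And>k. Ck_on k g W" "\<And>y. y \<in> S \<Longrightarrow> y \<in> W \<Longrightarrow> g y = f y"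
proof -
  obtain W g where "open W" "x \<in> W" "\<forall>k. Ck_on k g W" "\<forall>y\<in>S \<inter> W. g y = f y"
    using assms unfolding smooth_on_def by blast
  then show ?thesis by (intro that[of W g]) auto
qed

lemma smooth_onI:
  assumes "\<And>x. x \<in> S \<Longrightarrow> \<exists>W g. open W \<and> x \<in> W \<and> (\<forall>k. Ck_on k g W) \<and> (\<forall>y\<in>S \<inter> W. g y = f y)"
  shows "smooth_on f S"
  using assms unfolding smooth_on_def by blast

lemma smooth_on_imp_continuous_on:
  assumes "smooth_on f S"
  shows "continuous_on S f"
  unfolding continuous_on_def
proof
  fix x assume x: "x \<in> S"
  obtain W g where W: "open W" "x \<in> W" "\<And>k. Ck_on k g W" "\<And>y. y \<in> S \<Longrightarrow> y \<in> W \<Longrightarrow> g y = f y"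
    using smooth_onE[OF assms x] by blast
  have "continuous_on W g" using W(3)[of 0] by simp
  then have "(g \<longlongrightarrow> g x) (at x)"
    using W(1,2) by (simp add: continuous_on_eq_continuous_at isCont_def)
  then have "(g \<longlongrightarrow> g x) (at x within S)"
    by (rule tendsto_within_subset) simp
  then have "(g \<longlongrightarrow> f x) (at x within S)"
    by (simp add: W(4)[OF x W(2)])
  then show "(f \<longlongrightarrow> f x) (at x within S)"
    by (rule Lim_transform_eventually) (use W in \<open>auto simp: eventually_at_topological\<close>)
qed

lemma smooth_on_const: "smooth_on (\<lambda>x. c) S"
  by (intro smooth_onI exI[of _ UNIV] exI[of _ "\<lambda>x. c"]) (simp add: Ck_on_const)

lemma smooth_on_add:
  assumes "smooth_on f S" "smooth_on g S"
  shows "smooth_on (\<lambda>x. f x + g x) S"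
proof (rule smooth_onI)
  fix x assume x: "x \<in> S"
  obtain V u where V: "open V" "x \<in> V" "\<And>k. Ck_on k u V" "\<And>y. y \<in> S \<Longrightarrow> y \<in> V \<Longrightarrow> u y = f y"
    using smooth_onE[OF assms(1) x] by blast
  obtain W v where W: "open W" "x \<in> W" "\<And>k. Ck_on k v W" "\<And>y. y \<in> S \<Longrightarrow> y \<in> W \<Longrightarrow> v y = g y"
    using smooth_onE[OF assms(2) x] by blast
  have "Ck_on k (\<lambda>x. u x + v x) (V \<inter> W)" for k
    by (intro Ck_on_add open_Int V(1) W(1) Ck_on_subset[OF V(3)] Ck_on_subset[OF W(3)]) auto
  then show "\<exists>W g'. open W \<and> x \<in> W \<and> (\<forall>k. Ck_on k g' W) \<and> (\<forall>y\<in>S \<inter> W. g' y = f y + g y)"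
    using V W by (intro exI[of _ "V \<inter> W"] exI[of _ "\<lambda>x. u x + v x"]) auto
qed

lemma smooth_on_compose_real:
  fixes F :: "real \<Rightarrow> real"
  assumes "\<And>k. Ck_on k F UNIV" "smooth_on f S"
  shows "smooth_on (\<lambda>x. F (f x)) S"
proof (rule smooth_onI)
  fix x assume x: "x \<in> S"
  obtain W v where W: "open W" "x \<in> W" "\<And>k. Ck_on k v W" "\<And>y. y \<in> S \<Longrightarrow> y \<in> W \<Longrightarrow> v y = f y"
    using smooth_onE[OF assms(2) x] by blast
  have "Ck_on k (\<lambda>x. F (v x)) W" for k
    by (rule Ck_on_compose_real[OF W(1) assms(1) W(3)])
  then show "\<exists>W g. open W \<and> x \<in> W \<and> (\<forall>k. Ck_on k g W) \<and> (\<forall>y\<in>S \<inter> W. g y = F (f y))"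
    using W by (intro exI[of _ W] exI[of _ "\<lambda>x. F (v x)"]) auto
qed

lemma smooth_atlas_chartD:
  assumes "smooth_atlas B \<A>" "(U, \<phi>) \<in> \<A>"
  shows "open U" "homeomorphism U (\<phi> ` U) \<phi> (inv_into U \<phi>)" "\<phi> ` U \<subseteq> span B"
    "openin (top_of_set (span B)) (\<phi> ` U) \<or> (\<exists>b\<in>B. openin (top_of_set {x \<in> span B. 0 \<le> x \<bullet> b}) (\<phi> ` U))"
proof -
  have "is_chart B (U, \<phi>)" using assms unfolding smooth_atlas_def by blast
  then show "open U" "homeomorphism U (\<phi> ` U) \<phi> (inv_into U \<phi>)"
    and img: "openin (top_of_set (span B)) (\<phi> ` U) \<or> (\<exists>b\<in>B. openin (top_of_set {x \<in> span B. 0 \<le> x \<bullet> b}) (\<phi> ` U))"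
    by (auto simp: is_chart_def)
  from img show "\<phi> ` U \<subseteq> span B"
    by (auto dest: openin_imp_subset)
qed

lemma smooth_atlas_Union: "smooth_atlas B \<A> \<Longrightarrow> \<Union>(fst ` \<A>) = UNIV"
  by (simp add: smooth_atlas_def case_prod_unfold)

lemma smooth_atlas_transition:
  "smooth_atlas B \<A> \<Longrightarrow> (U, \<phi>) \<in> \<A> \<Longrightarrow> (V, \<psi>) \<in> \<A> \<Longrightarrow>
    smooth_on (\<psi> \<circ> inv_into U \<phi>) (\<phi> ` (U \<inter> V))"
  unfolding smooth_atlas_def by fast

text \<open>The points near which a chart image is open in \<open>span B\<close> form a relatively
  open set. Its preimage is open in the manifold, and the same chart witnesses that all its points
  are interior.\<close>

lemma open_manifold_interior:
  assumes "smooth_atlas B \<A>"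
  shows "open (manifold_interior B \<A>)"
proof (subst open_subopen, safe)
  fix p assume "p \<in> manifold_interior B \<A>"
  then obtain U \<phi> where c: "(U, \<phi>) \<in> \<A>" "p \<in> U" "\<phi> p \<in> top_of_set (span B) interior_of (\<phi> ` U)"
    by (auto simp: manifold_interior_def)
  note ch = smooth_atlas_chartD[OF assms c(1)]
  let ?I = "top_of_set (span B) interior_of (\<phi> ` U)"
  have sub: "?I \<subseteq> \<phi> ` U" by (rule interior_of_subset)
  have "openin (top_of_set (\<phi> ` U)) ?I"
    by (rule openin_subset_trans[OF openin_interior_of sub ch(3)])
  then have "openin (top_of_set U) (inv_into U \<phi> ` ?I)"
    by (rule homeomorphism_imp_open_map[OF homeomorphism_symD[OF ch(2)]])
  then have op: "open (inv_into U \<phi> ` ?I)"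
    using ch(1) openin_open_trans by blast
  have "p \<in> inv_into U \<phi> ` ?I"
    using c(2,3) homeomorphism_apply1[OF ch(2)] by (metis imageI)
  moreover have "inv_into U \<phi> ` ?I \<subseteq> manifold_interior B \<A>"
  proof
    fix x assume "x \<in> inv_into U \<phi> ` ?I"
    then obtain y where y: "y \<in> ?I" "x = inv_into U \<phi> y" by blast
    then have "x \<in> U" "\<phi> x = y"
      using sub by (auto simp: inv_into_into f_inv_into_f)
    then show "x \<in> manifold_interior B \<A>"
      unfolding manifold_interior_def using y(1) by (intro CollectI bexI[OF _ c(1)]) simp
  qed
  ultimately show "\<exists>T. open T \<and> p \<in> T \<and> T \<subseteq> manifold_interior B \<A>"
    using op by blast
qed

lemma smooth_function_continuous:
  assumes "smooth_atlas B \<A>" "smooth_function \<A> f"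
  shows "continuous_on UNIV f"
proof -
  have "continuous_on (\<Union>c\<in>\<A>. fst c) f"
  proof (rule continuous_on_open_UN)
    fix c assume "c \<in> \<A>"
    then obtain U \<phi> where c: "c = (U, \<phi>)" "(U, \<phi>) \<in> \<A>" by (cases c) auto
    note ch = smooth_atlas_chartD[OF assms(1) c(2)]
    show "open (fst c)" using ch c by simp
    have "smooth_on (f \<circ> inv_into U \<phi>) (\<phi> ` U)"
      using assms(2) c(2) unfolding smooth_function_def by blast
    then have "continuous_on U ((f \<circ> inv_into U \<phi>) \<circ> \<phi>)"
      by (rule continuous_on_compose[OF homeomorphism_cont1[OF ch(2)] smooth_on_imp_continuous_on])
    then have "continuous_on U f"
      by (rule continuous_on_eq) (simp add: homeomorphism_apply1[OF ch(2)])
    then show "continuous_on (fst c) f"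
      by (simp add: c(1))
  qed
  then show ?thesis by (simp add: smooth_atlas_Union[OF assms(1)])
qed

section \<open>Closure properties and boundedness of test functions\<close>

lemma Cc_infinity_interiorI:
  assumes "smooth_function \<A> f" "compact K" "{p. f p \<noteq> 0} \<subseteq> K" "K \<subseteq> manifold_interior B \<A>"
  shows "(f :: 'a::t2_space \<Rightarrow> real) \<in> Cc_infinity_interior B \<A>"
proof -
  have "closure {p. f p \<noteq> 0} \<subseteq> K"
    using closure_minimal[OF assms(3) compact_imp_closed[OF assms(2)]] .
  moreover from this have "compact (closure {p. f p \<noteq> 0})"
    using compact_Int_closed[OF assms(2) closed_closure, of "{p. f p \<noteq> 0}"] by (simp add: Int_absorb1)
  ultimately show ?thesis
    using assms(1,4) by (auto simp: Cc_infinity_interior_def)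
qed

lemma Cc_infinity_interior_zero: "(\<lambda>x. 0) \<in> Cc_infinity_interior B \<A>"
  by (auto simp: Cc_infinity_interior_def smooth_function_def comp_def intro: smooth_on_const)

lemma Cc_infinity_interior_add:
  assumes "f \<in> Cc_infinity_interior B \<A>" "g \<in> Cc_infinity_interior B \<A>"
  shows "(\<lambda>x. f x + g x :: real) \<in> Cc_infinity_interior B (\<A> :: ('a::t2_space, 'b::euclidean_space) chart set)"
proof (rule Cc_infinity_interiorI)
  show "smooth_function \<A> (\<lambda>x. f x + g x)"
    using assms by (auto simp: Cc_infinity_interior_def smooth_function_def comp_def intro!: smooth_on_add)
  show "compact (closure {p. f p \<noteq> 0} \<union> closure {p. g p \<noteq> 0})"
    using assms by (auto simp: Cc_infinity_interior_def)
  show "closure {p. f p \<noteq> 0} \<union> closure {p. g p \<noteq> 0} \<subseteq> manifold_interior B \<A>"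
    using assms by (auto simp: Cc_infinity_interior_def)
  have "{p. f p + g p \<noteq> 0} \<subseteq> {p. f p \<noteq> 0} \<union> {p. g p \<noteq> 0}" by auto
  then show "{p. f p + g p \<noteq> 0} \<subseteq> closure {p. f p \<noteq> 0} \<union> closure {p. g p \<noteq> 0}"
    using closure_subset[of "{p. f p \<noteq> 0}"] closure_subset[of "{p. g p \<noteq> 0}"] by blast
qed

lemma Cc_infinity_interior_sum:
  assumes "\<And>i. i \<in> I \<Longrightarrow> f i \<in> Cc_infinity_interior B (\<A> :: ('a::t2_space, 'b::euclidean_space) chart set)"
  shows "(\<lambda>x. \<Sum>i\<in>I. f i x) \<in> Cc_infinity_interior B \<A>"
  using assms
  by (induction I rule: infinite_finite_induct)
    (auto intro: Cc_infinity_interior_zero Cc_infinity_interior_add)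

text \<open>\<open>F 0 = 0\<close> keeps the support from growing, and smoothness is the chain rule
  in each chart.\<close>

lemma Cc_infinity_interior_compose:
  assumes "\<And>k. Ck_on k F UNIV" "F 0 = 0"
    and "f \<in> Cc_infinity_interior B (\<A> :: ('a::t2_space, 'b::euclidean_space) chart set)"
  shows "(\<lambda>x. F (f x)) \<in> Cc_infinity_interior B \<A>"
proof (rule Cc_infinity_interiorI)
  show "smooth_function \<A> (\<lambda>x. F (f x))"
    unfolding smooth_function_def
  proof safe
    fix U \<phi> assume "(U, \<phi>) \<in> \<A>"
    then have "smooth_on (f \<circ> inv_into U \<phi>) (\<phi> ` U)"
      using assms(3) by (auto simp: Cc_infinity_interior_def smooth_function_def)
    from smooth_on_compose_real[OF assms(1) this]
    show "smooth_on ((\<lambda>x. F (f x)) \<circ> inv_into U \<phi>) (\<phi> ` U)" by (simp add: comp_def)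
  qed
  show "compact (closure {p. f p \<noteq> 0})" "closure {p. f p \<noteq> 0} \<subseteq> manifold_interior B \<A>"
    using assms(3) by (auto simp: Cc_infinity_interior_def)
  have "{p. F (f p) \<noteq> 0} \<subseteq> {p. f p \<noteq> 0}" using assms(2) by auto
  then show "{p. F (f p) \<noteq> 0} \<subseteq> closure {p. f p \<noteq> 0}"
    using closure_subset[of "{p. f p \<noteq> 0}"] by blast
qed

lemma Cc_infinity_interior_continuous:
  "smooth_atlas B \<A> \<Longrightarrow> f \<in> Cc_infinity_interior B \<A> \<Longrightarrow> continuous_on UNIV f"
  by (rule smooth_function_continuous) (auto simp: Cc_infinity_interior_def)

lemma Cc_infinity_interior_measurable:
  assumes "smooth_atlas B \<A>" "positive_smooth_density B \<A> M" "f \<in> Cc_infinity_interior B \<A>"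
  shows "f \<in> borel_measurable M"
proof -
  have sets: "sets M = sets borel" using assms(2) by (simp add: positive_smooth_density_def)
  show ?thesis
    unfolding measurable_cong_sets[OF sets refl]
    by (rule borel_measurable_continuous_onI[OF Cc_infinity_interior_continuous[OF assms(1,3)]])
qed

text \<open>A continuous function is bounded on its compact support and zero elsewhere. The bound is
  what lets multiplication by a test function preserve square integrability.\<close>

lemma Cc_infinity_interior_bounded:
  assumes "smooth_atlas B \<A>" "f \<in> Cc_infinity_interior B \<A>"
  obtains C where "\<And>x. \<bar>f x\<bar> \<le> C"
proof -
  let ?K = "closure {p. f p \<noteq> 0}"
  have "compact ?K" using assms(2) by (simp add: Cc_infinity_interior_def)
  then have "compact (f ` ?K)"
    by (rule compact_continuous_image[OF continuous_on_subset[OF Cc_infinity_interior_continuous[OF assms] subset_UNIV]])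
  then obtain C where C: "\<forall>y\<in>f ` ?K. norm y \<le> C"
    using compact_imp_bounded bounded_iff by blast
  have "\<bar>f x\<bar> \<le> max C 0" for x
  proof (cases "f x = 0")
    case False
    then have "x \<in> ?K" using closure_subset[of "{p. f p \<noteq> 0}"] by blast
    then have "\<bar>f x\<bar> \<le> C" using C by simp
    then show ?thesis by simp
  qed simp
  then show ?thesis by (rule that)
qed

text \<open>In one chart, \<open>plateau\<close> of e^2 minus the squared coordinate distance to
  \<open>\<phi> p\<close> is a smooth bump supported in a ball. The delicate point is that its
  extension by zero is smooth in every other chart, including charts that leave
  \<open>U\<close>.\<close>

lemma Cc_infinity_interior_bump:
  fixes \<A> :: "('a::{t2_space, second_countable_topology}, 'b::euclidean_space) chart set"
  assumes at: "smooth_atlas B \<A>" and D: "open D" "D \<subseteq> manifold_interior B \<A>" "p \<in> D"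
  obtains \<sigma> where "\<sigma> \<in> Cc_infinity_interior B \<A>" "\<And>x. 0 \<le> \<sigma> x" "{x. 0 < \<sigma> x} \<subseteq> D" "0 < \<sigma> p"
proof -
  obtain U \<phi> where c: "(U, \<phi>) \<in> \<A>" "p \<in> U" "\<phi> p \<in> top_of_set (span B) interior_of (\<phi> ` U)"
    using D(2,3) by (auto simp: manifold_interior_def)
  note ch = smooth_atlas_chartD[OF at c(1)]
  let ?I = "top_of_set (span B) interior_of (\<phi> ` U)"
  let ?inv = "inv_into U \<phi>"
  have "openin (top_of_set U) (U \<inter> D)" using D(1) by (simp add: openin_open_Int)
  from homeomorphism_imp_open_map[OF ch(2) this]
  obtain T where T: "open T" "\<phi> ` (U \<inter> D) = \<phi> ` U \<inter> T" by (auto simp: openin_open)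
  have "openin (top_of_set (span B)) (?I \<inter> T)"
    by (intro openin_Int_open openin_interior_of T)
  moreover have "\<phi> p \<in> ?I \<inter> T" using c D(3) T(2) by blast
  \<comment> \<open>The ball is closed so that its trace on \<open>span B\<close> is compact and
    pulls back to a compact set \<open>K\<close>.\<close>
  ultimately obtain e where e: "e > 0" "cball (\<phi> p) e \<inter> span B \<subseteq> ?I \<inter> T"
    unfolding openin_contains_cball by blast
  define K where "K = ?inv ` (cball (\<phi> p) e \<inter> span B)"
  have K0: "cball (\<phi> p) e \<inter> span B \<subseteq> \<phi> ` (U \<inter> D)" "cball (\<phi> p) e \<inter> span B \<subseteq> \<phi> ` U"
    using e(2) interior_of_subset[of "top_of_set (span B)" "\<phi> ` U"] T(2) by blast+
  have compK: "compact K"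
    unfolding K_def
    by (intro compact_continuous_image continuous_on_subset[OF homeomorphism_cont2[OF ch(2)] K0(2)]
        compact_Int_closed compact_cball closed_span)
  have inK: "x \<in> U \<and> x \<in> D \<and> x \<in> manifold_interior B \<A>" if x: "x \<in> K" for x
  proof -
    obtain y where y: "y \<in> cball (\<phi> p) e \<inter> span B" "x = ?inv y" using x unfolding K_def by blast
    then obtain z where z: "z \<in> U" "z \<in> D" "y = \<phi> z" using K0(1) by blast
    then have "x = z" using y homeomorphism_apply1[OF ch(2)] by metis
    then show ?thesis using z D(2) by blast
  qed
  define \<sigma> where "\<sigma> x = (if x \<in> U then plateau (e\<^sup>2 - (norm (\<phi> x - \<phi> p))\<^sup>2) else 0)" for x
  have nonneg: "0 \<le> \<sigma> x" for x by (simp add: \<sigma>_def plateau_nonneg)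
  have supp: "x \<in> K" if "\<sigma> x \<noteq> 0" for x
  proof -
    have x: "x \<in> U" "(norm (\<phi> x - \<phi> p))\<^sup>2 < e\<^sup>2"
      using that by (auto simp: \<sigma>_def plateau_eq_0_iff split: if_splits)
    then have "norm (\<phi> x - \<phi> p) < e" using e(1) by (intro power2_less_imp_less[of _ e]) auto
    then have "\<phi> x \<in> cball (\<phi> p) e \<inter> span B"
      using x(1) ch(3) by (auto simp: dist_norm norm_minus_commute)
    then show ?thesis
      unfolding K_def using homeomorphism_apply1[OF ch(2) x(1)] by (metis imageI)
  qed
  have "smooth_function \<A> \<sigma>"
    unfolding smooth_function_def
  proof safe
    fix V \<psi> assume V: "(V, \<psi>) \<in> \<A>"
    note cV = smooth_atlas_chartD[OF at V]
    let ?inw = "inv_into V \<psi>"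
    show "smooth_on (\<sigma> \<circ> ?inw) (\<psi> ` V)"
    proof (rule smooth_onI)
      fix y assume y: "y \<in> \<psi> ` V"
      have inw: "?inw y \<in> V" "y = \<psi> (?inw y)"
        using inv_into_into[OF y] f_inv_into_f[OF y] by simp_all
      show "\<exists>W g. open W \<and> y \<in> W \<and> (\<forall>k. Ck_on k g W) \<and> (\<forall>z\<in>\<psi> ` V \<inter> W. g z = (\<sigma> \<circ> ?inw) z)"
      proof (cases "?inw y \<in> U")
        case True
        then have yVU: "y \<in> \<psi> ` (V \<inter> U)"
          by (subst inw(2)) (intro imageI IntI inw(1))
        obtain W g where W: "open W" "y \<in> W" "\<And>k. Ck_on k g W"
            "\<And>z. z \<in> \<psi> ` (V \<inter> U) \<Longrightarrow> z \<in> W \<Longrightarrow> g z = (\<phi> \<circ> ?inw) z"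
          using smooth_onE[OF smooth_atlas_transition[OF at V c(1)] yVU] by blast
        have "openin (top_of_set V) (V \<inter> U)" using ch(1) by (simp add: openin_open_Int)
        from homeomorphism_imp_open_map[OF cV(2) this]
        obtain S where S: "open S" "\<psi> ` (V \<inter> U) = \<psi> ` V \<inter> S" by (auto simp: openin_open)
        \<comment> \<open>\<open>g\<close> extends the transition map to the ambient open set
          \<open>W\<close>, and intersecting with \<open>S\<close> restricts to images of points of
          the overlap, where \<open>g\<close> agrees with that map. The subtraction is spelled with
          sums and a factor -1 to fit the closure rules.\<close>
        define G where "G z = plateau (e\<^sup>2 + (- 1) * (norm (g z + - \<phi> p))\<^sup>2)" for z
        have "Ck_on k G (W \<inter> S)" for k
        proof -
          have op: "open (W \<inter> S)" using W(1) S(1) by (rule open_Int)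
          have "Ck_on k (\<lambda>z. g z + - \<phi> p) (W \<inter> S)"
            by (intro Ck_on_add Ck_on_const Ck_on_subset[OF W(3)] op) simp
          then have "Ck_on k (\<lambda>z. (norm (g z + - \<phi> p))\<^sup>2) (W \<inter> S)"
            by (rule Ck_on_norm_square[OF op])
          then have "Ck_on k (\<lambda>z. e\<^sup>2 + (- 1) * (norm (g z + - \<phi> p))\<^sup>2) (W \<inter> S)"
            by (intro Ck_on_add Ck_on_const Ck_on_scale_real op)
          then show ?thesis
            unfolding G_def by (rule Ck_on_compose_real[OF op Ck_on_plateau])
        qed
        moreover have "G z = (\<sigma> \<circ> ?inw) z" if z: "z \<in> \<psi> ` V \<inter> (W \<inter> S)" for z
        proof -
          have zVU: "z \<in> \<psi> ` (V \<inter> U)" using z S(2) by blast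
          then obtain v where v: "v \<in> V" "v \<in> U" "z = \<psi> v" by blast
          then have "?inw z = v" by (simp add: homeomorphism_apply1[OF cV(2)])
          moreover have "g z = \<phi> (?inw z)" using W(4)[OF zVU] z by simp
          ultimately show ?thesis using v(2) by (simp add: G_def \<sigma>_def)
        qed
        ultimately show ?thesis
          using open_Int[OF W(1) S(1)] W(2) yVU[unfolded S(2)]
          by (intro exI[of _ "W \<inter> S"] exI[of _ G] conjI allI ballI) blast+
      next
        case False
        \<comment> \<open>\<open>K\<close> is contained in \<open>U\<close> and closed, being
          compact in a Hausdorff space. So a point outside \<open>U\<close> has a whole
          neighbourhood that misses \<open>K\<close>, where \<open>\<sigma>\<close> is zero.\<close>
        then have "?inw y \<notin> K" using inK by blast
        moreover have "openin (top_of_set V) (V - K)"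
          using compact_imp_closed[OF compK] by (simp add: Diff_eq openin_open_Int open_Compl)
        from homeomorphism_imp_open_map[OF cV(2) this]
        obtain S where S: "open S" "\<psi> ` (V - K) = \<psi> ` V \<inter> S" by (auto simp: openin_open)
        moreover have "\<psi> (?inw y) \<in> \<psi> ` (V - K)"
          by (intro imageI DiffI inw(1) \<open>?inw y \<notin> K\<close>)
        ultimately have "y \<in> S"
          unfolding inw(2)[symmetric] by simp
        moreover have "(\<sigma> \<circ> ?inw) z = 0" if z: "z \<in> \<psi> ` V \<inter> S" for z
        proof -
          obtain v where v: "v \<in> V" "v \<notin> K" "z = \<psi> v" using z unfolding S(2)[symmetric] by blast
          then have "?inw z = v" by (simp add: homeomorphism_apply1[OF cV(2)])
          then show ?thesis using supp[of v] v(2) by auto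
        qed
        ultimately show ?thesis
          using S(1) by (intro exI[of _ S] exI[of _ "\<lambda>z. 0"] conjI allI ballI Ck_on_const) simp_all
      qed
    qed
  qed
  then have "\<sigma> \<in> Cc_infinity_interior B \<A>"
    by (rule Cc_infinity_interiorI[OF _ compK]) (use supp inK in blast)+
  moreover have "{x. 0 < \<sigma> x} \<subseteq> D"
  proof
    fix x assume "x \<in> {x. 0 < \<sigma> x}"
    then have "x \<in> K" by (intro supp) simp
    then show "x \<in> D" using inK by blast
  qed
  moreover have "0 < \<sigma> p" using c(2) e(1) by (simp add: \<sigma>_def plateau_pos_iff)
  ultimately show ?thesis using that nonneg by blast
qed

text \<open>The Lindelof property yields countably many bumps \<open>\<tau> i\<close> whose positivity sets cover the open set.
  As \<open>plateau\<close> vanishes on the negative half-line and tends to 1 at infinity, the functions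
  \<open>plateau (n * (\<Sum>i<n. \<tau> i x))\<close> converge to the indicator.\<close>

lemma indicator_approx_Cc_infinity_interior:
  fixes \<A> :: "('a::{t2_space, second_countable_topology}, 'b::euclidean_space) chart set"
  assumes at: "smooth_atlas B \<A>" and D: "open D" "D \<subseteq> manifold_interior B \<A>"
  obtains s :: "nat \<Rightarrow> 'a \<Rightarrow> real" where "\<And>n. s n \<in> Cc_infinity_interior B \<A>"
    "\<And>n x. 0 \<le> s n x" "\<And>n x. s n x \<le> 1" "\<And>x. (\<lambda>n. s n x) \<longlonglongrightarrow> indicator D x"
proof -
  define S where "S = {\<sigma> \<in> Cc_infinity_interior B \<A>. (\<forall>x. 0 \<le> \<sigma> x) \<and> {x. 0 < \<sigma> x} \<subseteq> D}"
  define pos where "pos \<sigma> = {x. 0 < \<sigma> x}" for \<sigma> :: "'a \<Rightarrow> real"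
  have "\<And>P. P \<in> pos ` S \<Longrightarrow> open P"
    using Cc_infinity_interior_continuous[OF at]
    by (auto simp: S_def pos_def intro!: open_Collect_less continuous_intros)
  then obtain \<F> where F: "\<F> \<subseteq> pos ` S" "countable \<F>" "\<Union>\<F> = \<Union>(pos ` S)"
    using Lindelof by blast
  obtain S' where S': "countable S'" "S' \<subseteq> S" "\<F> = pos ` S'"
    using F(1,2) by (meson countable_subset_image)
  have zS: "(\<lambda>x. 0) \<in> S" by (auto simp: S_def Cc_infinity_interior_zero)
  \<comment> \<open>\<open>from_nat_into\<close> enumerates only nonempty sets, and
    \<open>S'\<close> is empty when \<open>D\<close> is; the zero function is a harmless extra
    member.\<close>
  define \<tau> where "\<tau> = from_nat_into (insert (\<lambda>x. 0) S')"
  have range: "range \<tau> = insert (\<lambda>x. 0) S'"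
    unfolding \<tau>_def by (rule range_from_nat_into) (use S' in auto)
  then have \<tau>S: "\<tau> i \<in> S" for i using S'(2) zS by (metis insertE rangeI subsetD)
  have cover: "\<exists>i. 0 < \<tau> i x" if x: "x \<in> D" for x
  proof -
    obtain \<sigma> where "\<sigma> \<in> Cc_infinity_interior B \<A>" "\<And>x. 0 \<le> \<sigma> x" "{x. 0 < \<sigma> x} \<subseteq> D" "0 < \<sigma> x"
      using Cc_infinity_interior_bump[OF at D x] by metis
    then have "\<sigma> \<in> S" "0 < \<sigma> x" by (auto simp: S_def)
    then have "x \<in> \<Union>\<F>" unfolding F(3) by (auto simp: pos_def)
    then obtain \<sigma>' where "\<sigma>' \<in> S'" "0 < \<sigma>' x" unfolding S'(3) by (auto simp: pos_def)
    then show ?thesis using range by (metis insertCI rangeE)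
  qed
  define t where "t n x = (\<Sum>i<n. \<tau> i x)" for n x
  define s where "s n x = plateau (real n * t n x)" for n x
  have \<tau>0: "0 \<le> \<tau> i x" for i x using \<tau>S by (auto simp: S_def)
  have "s n \<in> Cc_infinity_interior B \<A>" for n
  proof -
    have t: "t n \<in> Cc_infinity_interior B \<A>"
      unfolding t_def using \<tau>S by (intro Cc_infinity_interior_sum) (simp add: S_def)
    have "Ck_on k (\<lambda>x. x) (UNIV :: real set)" for k
      by (cases k) (auto simp: frechet_derivative_ident intro: Ck_on_const)
    then have "Ck_on k (\<lambda>x. plateau (real n * x)) UNIV" for k
      by (intro Ck_on_compose_real[OF open_UNIV Ck_on_plateau] Ck_on_scale_real) auto
    from Cc_infinity_interior_compose[OF this _ t] show ?thesis
      by (simp add: s_def[abs_def] plateau_eq_0_iff)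
  qed
  moreover have "(\<lambda>n. s n x) \<longlonglongrightarrow> indicator D x" for x
  proof (cases "x \<in> D")
    case True
    then obtain i where i: "0 < \<tau> i x" using cover by blast
    \<comment> \<open>Once n > i, the partial sum of nonnegative terms is at least the single
      positive value \<open>\<tau> i x\<close>, and the factor n then drives the argument to
      infinity.\<close>
    have "filterlim (\<lambda>n. real n * t n x) at_top sequentially"
    proof (rule filterlim_at_top_mono)
      show "filterlim (\<lambda>n. real n * \<tau> i x) at_top sequentially"
        by (intro filterlim_at_top_mult_tendsto_pos[OF tendsto_const] i filterlim_real_sequentially)
      show "\<forall>\<^sub>F n in sequentially. real n * \<tau> i x \<le> real n * t n x"
        using eventually_gt_at_top[of i]
      proof eventually_elim
        case (elim n)
        then have "\<tau> i x \<le> t n x" unfolding t_def by (intro member_le_sum \<tau>0) auto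
        then show ?case by (rule mult_left_mono) simp
      qed
    qed
    from filterlim_compose[OF plateau_tendsto_1 this] show ?thesis
      using True by (simp add: s_def)
  next
    case False
    then have "\<not> 0 < \<tau> i x" for i
      using \<tau>S[of i] unfolding S_def by blast
    then have "\<tau> i x = 0" for i
      using \<tau>0[of i x] by (metis order_le_less)
    then show ?thesis using False by (simp add: s_def t_def plateau_def)
  qed
  moreover have "0 \<le> s n x" "s n x \<le> 1" for n x
    by (simp_all add: s_def plateau_nonneg plateau_le_1)
  ultimately show ?thesis by (intro that[of s])
qed

section \<open>The boundary is a null set\<close>

text \<open>Under the coordinate map the hyperplane pulls back to a box with one side {0}. Its
  product measure has a zero factor, and in \<open>ennreal\<close> this wins over the infinite
  factors.\<close>

lemma lborel_span_hyperplane_null: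
  assumes B: "B \<subseteq> Basis" and b: "b \<in> B"
  shows "{x. x \<bullet> b = 0} \<in> null_sets (lborel_span (B :: 'b::euclidean_space set))"
proof -
  interpret product_sigma_finite "\<lambda>_::'b. lborel :: real measure" ..
  have fin: "finite B" using B finite_Basis finite_subset by blast
  have dot: "(\<Sum>c\<in>B. x c *\<^sub>R c) \<bullet> b = x b" for x :: "'b \<Rightarrow> real"
  proof -
    have "(\<Sum>c\<in>B. x c *\<^sub>R c) \<bullet> b = (\<Sum>c\<in>B. if c = b then x c else 0)"
      unfolding inner_sum_left
    proof (rule sum.cong)
      fix c assume "c \<in> B"
      then have "c \<in> Basis" "b \<in> Basis" using B b by auto
      then show "x c *\<^sub>R c \<bullet> b = (if c = b then x c else 0)"
        by (simp add: inner_Basis)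
    qed simp
    then show ?thesis using fin b by simp
  qed
  let ?P = "\<Pi>\<^sub>M c\<in>B. (lborel :: real measure)"
  have m: "(\<lambda>x. \<Sum>c\<in>B. x c *\<^sub>R c) \<in> measurable ?P borel" by measurable
  have H: "{x::'b. x \<bullet> b = 0} \<in> sets borel" by measurable
  have "(\<lambda>x. \<Sum>c\<in>B. x c *\<^sub>R c) -` {x. x \<bullet> b = 0} \<inter> space ?P = Pi\<^sub>E B (\<lambda>c. if c = b then {0} else UNIV)"
    using b by (auto simp: dot space_PiM PiE_def Pi_def split: if_splits)
  then have "emeasure (lborel_span B) {x. x \<bullet> b = 0} = (\<Prod>c\<in>B. emeasure lborel (if c = b then {0::real} else UNIV))"
    unfolding lborel_span_def
    by (subst emeasure_distr[OF m H]) (simp, intro emeasure_PiM fin, auto)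
  also have "\<dots> = 0" using fin b by (auto simp: prod_zero_iff)
  finally show ?thesis
    using H by (simp add: null_sets_def lborel_span_def)
qed

text \<open>A chart containing a boundary point cannot have an image open in \<open>span B\<close>,
  so its image is open in a half-space. Points with positive \<open>b\<close>-coordinate are
  interior to that image in the full space; the boundary points must therefore have coordinate
  0.\<close>

lemma manifold_boundary_in_hyperplane:
  assumes at: "smooth_atlas B \<A>" and c: "(U, \<phi>) \<in> \<A>" and ne: "U - manifold_interior B \<A> \<noteq> {}"
  obtains b where "b \<in> B" "\<phi> ` (U - manifold_interior B \<A>) \<subseteq> {x. x \<bullet> b = 0}"
proof -
  note ch = smooth_atlas_chartD[OF at c]
  have out: "\<phi> p \<notin> top_of_set (span B) interior_of (\<phi> ` U)" if "p \<in> U - manifold_interior B \<A>" for p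
    using that c by (auto simp: manifold_interior_def)
  have "\<not> openin (top_of_set (span B)) (\<phi> ` U)"
    using out ne interior_of_openin by blast
  then obtain b where b: "b \<in> B" "openin (top_of_set {x \<in> span B. 0 \<le> x \<bullet> b}) (\<phi> ` U)"
    using ch(4) by blast
  then obtain T where T: "open T" "\<phi> ` U = {x \<in> span B. 0 \<le> x \<bullet> b} \<inter> T"
    by (auto simp: openin_open)
  have "\<phi> p \<bullet> b = 0" if p: "p \<in> U - manifold_interior B \<A>" for p
  proof (rule ccontr)
    assume "\<phi> p \<bullet> b \<noteq> 0"
    moreover have "\<phi> p \<in> {x \<in> span B. 0 \<le> x \<bullet> b} \<inter> T" using p T(2) by blast
    ultimately have "\<phi> p \<in> span B \<inter> (T \<inter> {x. 0 < x \<bullet> b})" by auto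
    moreover have "span B \<inter> (T \<inter> {x. 0 < x \<bullet> b}) \<subseteq> top_of_set (span B) interior_of (\<phi> ` U)"
    proof (rule interior_of_maximal)
      show "span B \<inter> (T \<inter> {x. 0 < x \<bullet> b}) \<subseteq> \<phi> ` U" unfolding T(2) by auto
      show "openin (top_of_set (span B)) (span B \<inter> (T \<inter> {x. 0 < x \<bullet> b}))"
        by (intro openin_open_Int open_Int T(1) open_Collect_less continuous_intros)
    qed
    ultimately show False using out[OF p] by blast
  qed
  then show ?thesis using that b(1) by blast
qed

text \<open>Within one chart the boundary has measure an integral over part of a hyperplane, hence
  zero. The Lindelof property reduces the atlas to countably many chart domains.\<close>

lemma manifold_boundary_null:
  fixes \<A> :: "('a::{t2_space, second_countable_topology}, 'b::euclidean_space) chart set"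
  assumes at: "smooth_atlas B \<A>" and dens: "positive_smooth_density B \<A> M"
  shows "- manifold_interior B \<A> \<in> null_sets M"
proof -
  let ?I = "manifold_interior B \<A>"
  have sets: "sets M = sets borel" using dens by (simp add: positive_smooth_density_def)
  have Iopen: "open ?I" by (rule open_manifold_interior[OF at])
  have chart_null: "U - ?I \<in> null_sets M" if c: "(U, \<phi>) \<in> \<A>" for U \<phi>
  proof (cases "U - ?I = {}")
    case False
    then obtain b where b: "b \<in> B" "\<phi> ` (U - ?I) \<subseteq> {x. x \<bullet> b = 0}"
      using manifold_boundary_in_hyperplane[OF at c] by blast
    have borel: "U - ?I \<in> sets borel"
      using Iopen smooth_atlas_chartD(1)[OF at c] by (intro sets.Diff) auto
    obtain \<rho> :: "'b \<Rightarrow> real" where "\<forall>S\<in>sets borel. S \<subseteq> U \<longrightarrow>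
        emeasure M S = (\<integral>\<^sup>+y\<in>\<phi> ` S. ennreal (\<rho> y) \<partial>lborel_span B)"
      using dens c unfolding positive_smooth_density_def by blast
    then have "emeasure M (U - ?I) = (\<integral>\<^sup>+y\<in>\<phi> ` (U - ?I). ennreal (\<rho> y) \<partial>lborel_span B)"
      using borel by simp
    also have "\<dots> = (\<integral>\<^sup>+y. 0 \<partial>lborel_span B)"
    proof (rule nn_integral_cong_AE)
      have "{x. x \<bullet> b = 0} \<in> null_sets (lborel_span B)"
        using at b(1) by (intro lborel_span_hyperplane_null) (auto simp: smooth_atlas_def)
      then have "AE y in lborel_span B. y \<notin> {x. x \<bullet> b = 0}" by (rule AE_not_in)
      then show "AE y in lborel_span B. ennreal (\<rho> y) * indicator (\<phi> ` (U - ?I)) y = 0"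
        by eventually_elim (use b(2) in \<open>auto simp: indicator_def\<close>)
    qed
    finally show ?thesis using borel sets by (simp add: null_sets_def)
  next
    case True
    show ?thesis unfolding True by simp
  qed
  have "\<And>U. U \<in> fst ` \<A> \<Longrightarrow> open U" using smooth_atlas_chartD(1)[OF at] by auto
  then obtain \<F> where F: "\<F> \<subseteq> fst ` \<A>" "countable \<F>" "\<Union>\<F> = \<Union>(fst ` \<A>)"
    by (rule Lindelof)
  have "\<Union>\<F> = UNIV" using F(3) smooth_atlas_Union[OF at] by (rule trans)
  moreover have "(\<Union>U\<in>\<F>. U - ?I) = \<Union>\<F> - ?I" by blast
  ultimately have "- ?I = (\<Union>U\<in>\<F>. U - ?I)" by (simp add: Compl_eq_Diff_UNIV)
  moreover have "(\<Union>U\<in>\<F>. U - ?I) \<in> null_sets M"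
    using F(1) chart_null by (intro null_sets_UN'[OF F(2)]) auto
  ultimately show ?thesis by simp
qed

section \<open>The fundamental lemma of the calculus of variations\<close>

text \<open>The Borel sets over which \<open>h\<close> integrates to 0 form a Dynkin system
  containing the intersection-stable family of open sets, so they are all Borel sets. Uniqueness of
  real densities, applied to \<open>h\<close> and 0, finishes the argument.\<close>

lemma integral_open_zero_imp_AE_zero:
  fixes h :: "'a::topological_space \<Rightarrow> real"
  assumes sets: "sets M = sets borel" and h: "integrable M h"
    and op: "\<And>D. open D \<Longrightarrow> (LINT x:D|M. h x) = 0"
  shows "AE x in M. h x = 0"
proof -
  have space: "space M = UNIV" using sets_eq_imp_space_eq[OF sets] by simp
  have int: "set_integrable M A h" if "A \<in> sets M" for A
    unfolding set_integrable_def using integrable_mult_indicator[OF that h] .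
  have "(LINT x:A|M. h x) = 0" if "A \<in> sets M" for A
  proof -
    have "Int_stable {S::'a set. open S}" by (auto simp: Int_stable_def)
    moreover have "{S::'a set. open S} \<subseteq> Pow UNIV" by simp
    moreover have "A \<in> sigma_sets UNIV {S. open S}" using that by (simp add: sets borel_def)
    ultimately show ?thesis
    proof (induction A rule: sigma_sets_induct_disjoint)
      case (basic A)
      then show ?case using op by simp
    next
      case empty
      show ?case by (simp add: set_lebesgue_integral_def)
    next
      case (compl A)
      then have A: "A \<in> sets M" by (simp add: sets borel_def)
      then have "(LINT x:A \<union> (UNIV - A)|M. h x) = (LINT x:A|M. h x) + (LINT x:UNIV - A|M. h x)"
        using space sets.compl_sets[OF A] by (intro set_integral_Un int) auto
      \<comment> \<open>The whole space is open, so the total integral is 0 and complements inherit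
        the property.\<close>
      then show ?case using compl op[of UNIV] by simp
    next
      case (union A)
      then have A: "range A \<subseteq> sets M" by (simp add: sets borel_def)
      have "(LINT x:(\<Union>i. A i)|M. h x) = (\<Sum>i. (LINT x:(A i)|M. h x))"
        using A union(1) by (intro lebesgue_integral_countable_add int) (auto simp: disjoint_family_on_def)
      then show ?case using union by simp
    qed
  qed
  then show ?thesis
    using density_unique_real[of M h "\<lambda>x. 0"] h by simp
qed

text \<open>The approximants lie between 0 and 1, so |h| dominates and the integral over
  \<open>D \<inter> manifold_interior B \<A>\<close> is a limit of zeros. Replacing this set by
  \<open>D\<close> costs only a null set.\<close>

lemma fundamental_lemma_real:
  fixes \<A> :: "('a::{t2_space, second_countable_topology}, 'b::euclidean_space) chart set" and h :: "'a \<Rightarrow> real"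
  assumes at: "smooth_atlas B \<A>" and dens: "positive_smooth_density B \<A> M" and h: "integrable M h"
    and zero: "\<And>\<sigma>. \<sigma> \<in> Cc_infinity_interior B \<A> \<Longrightarrow> (\<integral>x. \<sigma> x * h x \<partial>M) = 0"
  shows "AE x in M. h x = 0"
proof (rule integral_open_zero_imp_AE_zero[OF _ h])
  show sets: "sets M = sets borel" using dens by (simp add: positive_smooth_density_def)
  note [measurable] = borel_measurable_integrable[OF h]
  let ?I = "manifold_interior B \<A>"
  have Iopen: "open ?I" by (rule open_manifold_interior[OF at])
  fix D :: "'a set" assume D: "open D"
  obtain s :: "nat \<Rightarrow> 'a \<Rightarrow> real" where s: "\<And>n. s n \<in> Cc_infinity_interior B \<A>"
    "\<And>n x. 0 \<le> s n x" "\<And>n x. s n x \<le> 1" "\<And>x. (\<lambda>n. s n x) \<longlonglongrightarrow> indicator (D \<inter> ?I) x"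
    using indicator_approx_Cc_infinity_interior[OF at open_Int[OF D Iopen]] by blast
  have s_meas [measurable]: "s n \<in> borel_measurable M" for n
    by (rule Cc_infinity_interior_measurable[OF at dens s(1)])
  have D_meas: "D \<in> sets M" "D \<inter> ?I \<in> sets M" using D Iopen by (auto simp: sets)
  have "(\<lambda>n. \<integral>x. s n x * h x \<partial>M) \<longlonglongrightarrow> (\<integral>x. indicator (D \<inter> ?I) x * h x \<partial>M)"
  proof (rule integral_dominated_convergence[where w = "\<lambda>x. \<bar>h x\<bar>"])
    show "integrable M (\<lambda>x. \<bar>h x\<bar>)" using h by simp
    show "AE x in M. (\<lambda>n. s n x * h x) \<longlonglongrightarrow> indicator (D \<inter> ?I) x * h x"
      using s(4) by (intro AE_I2 tendsto_intros)
    show "AE x in M. norm (s n x * h x) \<le> \<bar>h x\<bar>" for n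
      using s(2,3) by (auto simp: abs_mult mult_left_le_one_le)
    show "(\<lambda>x. indicator (D \<inter> ?I) x * h x) \<in> borel_measurable M" using D_meas by measurable
  qed measurable
  then have "(\<integral>x. indicator (D \<inter> ?I) x * h x \<partial>M) = 0"
    using zero[OF s(1)] by (simp add: LIMSEQ_const_iff)
  moreover have "(\<integral>x. indicator (D \<inter> ?I) x * h x \<partial>M) = (\<integral>x. indicator D x * h x \<partial>M)"
  proof (rule integral_cong_AE)
    have "AE x in M. x \<notin> - ?I" by (rule AE_not_in[OF manifold_boundary_null[OF at dens]])
    then show "AE x in M. indicator (D \<inter> ?I) x * h x = indicator D x * h x"
      by eventually_elim (auto simp: indicator_def)
  qed (use D_meas in measurable)
  ultimately show "(LINT x:D|M. h x) = 0" by (simp add: set_lebesgue_integral_def)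
qed

text \<open>Test functions are real, so real and imaginary parts of the integral can be separated;
  integrability of the product is what permits this.\<close>

lemma fundamental_lemma_complex:
  fixes \<A> :: "('a::{t2_space, second_countable_topology}, 'b::euclidean_space) chart set" and h :: "'a \<Rightarrow> complex"
  assumes at: "smooth_atlas B \<A>" and dens: "positive_smooth_density B \<A> M" and h: "integrable M h"
    and zero: "\<And>\<sigma>. \<sigma> \<in> Cc_infinity_interior B \<A> \<Longrightarrow> (\<integral>x. of_real (\<sigma> x) * h x \<partial>M) = 0"
  shows "AE x in M. h x = 0"
proof -
  have int: "integrable M (\<lambda>x. of_real (\<sigma> x) * h x)" if \<sigma>C: "\<sigma> \<in> Cc_infinity_interior B \<A>" for \<sigma>
  proof -
    have [measurable]: "\<sigma> \<in> borel_measurable M"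
      by (rule Cc_infinity_interior_measurable[OF at dens \<sigma>C])
    note [measurable] = borel_measurable_integrable[OF h]
    obtain C where C: "\<And>x. \<bar>\<sigma> x\<bar> \<le> C" using Cc_infinity_interior_bounded[OF at \<sigma>C] by blast
    show ?thesis
    proof (rule Bochner_Integration.integrable_bound)
      show "integrable M (\<lambda>x. C * norm (h x))" using h by simp
      show "AE x in M. norm (of_real (\<sigma> x) * h x) \<le> norm (C * norm (h x))"
        by (auto simp: norm_mult abs_mult intro!: AE_I2 mult_right_mono order_trans[OF C abs_ge_self])
    qed measurable
  qed
  have "AE x in M. Re (h x) = 0"
  proof (rule fundamental_lemma_real[OF at dens])
    show "(\<integral>x. \<sigma> x * Re (h x) \<partial>M) = 0" if "\<sigma> \<in> Cc_infinity_interior B \<A>" for \<sigma>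
      using integral_Re[OF int[OF that]] zero[OF that] by simp
  qed (use h in simp)
  moreover have "AE x in M. Im (h x) = 0"
  proof (rule fundamental_lemma_real[OF at dens])
    show "(\<integral>x. \<sigma> x * Im (h x) \<partial>M) = 0" if "\<sigma> \<in> Cc_infinity_interior B \<A>" for \<sigma>
      using integral_Im[OF int[OF that]] zero[OF that] by simp
  qed (use h in simp)
  ultimately show ?thesis by eventually_elim (simp add: complex_eq_iff)
qed

section \<open>Square-integrable functions\<close>

text \<open>The inner product on functions rather than classes, linear in the first argument as in
  \<open>L2_inner\<close>.\<close>

definition ip :: "'a measure \<Rightarrow> ('a \<Rightarrow> complex) \<Rightarrow> ('a \<Rightarrow> complex) \<Rightarrow> complex" where
  "ip M f g = (\<integral>x. f x * cnj (g x) \<partial>M)"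

definition nsq :: "'a measure \<Rightarrow> ('a \<Rightarrow> complex) \<Rightarrow> real" where
  "nsq M f = (\<integral>x. (cmod (f x))\<^sup>2 \<partial>M)"

lemma square_integrableD:
  assumes "f \<in> square_integrable M"
  shows "f \<in> borel_measurable M" "integrable M (\<lambda>x. (cmod (f x))\<^sup>2)"
  using assms by (auto simp: square_integrable_def)

lemma square_integrable_bound:
  assumes "f \<in> borel_measurable M" "integrable M h" "\<And>x. (cmod (f x))\<^sup>2 \<le> h x"
  shows "f \<in> square_integrable M"
  unfolding square_integrable_def
  using assms(1,3) by (auto intro!: Bochner_Integration.integrable_bound[OF assms(2)] order_trans[OF assms(3) abs_ge_self])

lemma square_integrable_zero [simp]: "(\<lambda>x. 0) \<in> square_integrable M"
  by (simp add: square_integrable_def)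

lemma square_integrable_bounded_mult:
  assumes "f \<in> square_integrable M" "s \<in> borel_measurable M" "\<And>x. cmod (s x) \<le> C"
  shows "(\<lambda>x. s x * f x) \<in> square_integrable M"
proof (rule square_integrable_bound)
  note [measurable] = square_integrableD(1)[OF assms(1)] assms(2)
  show "(\<lambda>x. s x * f x) \<in> borel_measurable M" by measurable
  show "integrable M (\<lambda>x. C\<^sup>2 * (cmod (f x))\<^sup>2)"
    using square_integrableD(2)[OF assms(1)] by simp
  show "(cmod (s x * f x))\<^sup>2 \<le> C\<^sup>2 * (cmod (f x))\<^sup>2" for x
    unfolding norm_mult power_mult_distrib
    by (intro mult_right_mono power_mono assms(3)) auto
qed

lemma square_integrable_cmult:
  "f \<in> square_integrable M \<Longrightarrow> (\<lambda>x. c * f x) \<in> square_integrable M"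
  by (rule square_integrable_bounded_mult[where C = "cmod c"]) auto

lemma square_integrable_add:
  assumes "f \<in> square_integrable M" "g \<in> square_integrable M"
  shows "(\<lambda>x. f x + g x) \<in> square_integrable M"
proof (rule square_integrable_bound)
  note [measurable] = square_integrableD(1)[OF assms(1)] square_integrableD(1)[OF assms(2)]
  show "(\<lambda>x. f x + g x) \<in> borel_measurable M" by measurable
  show "integrable M (\<lambda>x. 2 * (cmod (f x))\<^sup>2 + 2 * (cmod (g x))\<^sup>2)"
    using square_integrableD(2)[OF assms(1)] square_integrableD(2)[OF assms(2)] by simp
  show "(cmod (f x + g x))\<^sup>2 \<le> 2 * (cmod (f x))\<^sup>2 + 2 * (cmod (g x))\<^sup>2" for x
  proof -
    have "(cmod (f x + g x))\<^sup>2 \<le> (cmod (f x) + cmod (g x))\<^sup>2"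
      by (intro power_mono norm_triangle_ineq) auto
    also have "\<dots> \<le> 2 * (cmod (f x))\<^sup>2 + 2 * (cmod (g x))\<^sup>2"
      using sum_squares_bound[of "cmod (f x)" "cmod (g x)"] by (simp add: power2_sum)
    finally show ?thesis .
  qed
qed

lemma square_integrable_diff:
  assumes "f \<in> square_integrable M" "g \<in> square_integrable M"
  shows "(\<lambda>x. f x - g x) \<in> square_integrable M"
  using square_integrable_add[OF assms(1) square_integrable_cmult[OF assms(2), of "-1"]] by simp

lemma borel_measurable_cnj [measurable]:
  "f \<in> borel_measurable M \<Longrightarrow> (\<lambda>x. cnj (f x)) \<in> borel_measurable M"
  by (rule measurable_compose[OF _ borel_measurable_continuous_onI]) (auto intro: continuous_intros)

lemma integrable_ip:
  assumes "f \<in> square_integrable M" "g \<in> square_integrable M"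
  shows "integrable M (\<lambda>x. f x * cnj (g x))"
proof (rule Bochner_Integration.integrable_bound)
  note [measurable] = square_integrableD(1)[OF assms(1)] square_integrableD(1)[OF assms(2)]
  show "integrable M (\<lambda>x. (cmod (f x))\<^sup>2 + (cmod (g x))\<^sup>2)"
    using square_integrableD(2)[OF assms(1)] square_integrableD(2)[OF assms(2)] by simp
  show "(\<lambda>x. f x * cnj (g x)) \<in> borel_measurable M" by measurable
  have "cmod (f x) * cmod (g x) \<le> (cmod (f x))\<^sup>2 + (cmod (g x))\<^sup>2" for x
    using sum_squares_bound[of "cmod (f x)" "cmod (g x)"]
      mult_nonneg_nonneg[OF norm_ge_zero[of "f x"] norm_ge_zero[of "g x"]] by linarith
  then show "AE x in M. norm (f x * cnj (g x)) \<le> norm ((cmod (f x))\<^sup>2 + (cmod (g x))\<^sup>2)"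
    by (simp add: norm_mult)
qed

lemma nsq_nonneg: "0 \<le> nsq M f"
  by (simp add: nsq_def)

lemma nsq_eq_0_iff:
  "f \<in> square_integrable M \<Longrightarrow> nsq M f = 0 \<longleftrightarrow> (AE x in M. f x = 0)"
  unfolding nsq_def
  by (subst integral_nonneg_eq_0_iff_AE) (auto dest: square_integrableD)

lemma ip_self: "ip M f f = complex_of_real (nsq M f)"
  by (simp add: ip_def nsq_def complex_norm_square[symmetric] del: of_real_power)

lemma ip_cong_AE:
  assumes "AE x in M. f x = f' x" "AE x in M. g x = g' x"
    and "f \<in> square_integrable M" "f' \<in> square_integrable M"
    and "g \<in> square_integrable M" "g' \<in> square_integrable M"
  shows "ip M f g = ip M f' g'"
  unfolding ip_def
proof (rule integral_cong_AE)
  note [measurable] = assms(3-6)[THEN square_integrableD(1)]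
  show "(\<lambda>x. f x * cnj (g x)) \<in> borel_measurable M" "(\<lambda>x. f' x * cnj (g' x)) \<in> borel_measurable M"
    by measurable
  show "AE x in M. f x * cnj (g x) = f' x * cnj (g' x)"
    using assms(1,2) by eventually_elim simp
qed

lemma nsq_cong_AE:
  assumes "AE x in M. f x = f' x" "f \<in> square_integrable M" "f' \<in> square_integrable M"
  shows "nsq M f = nsq M f'"
  using ip_cong_AE[OF assms(1,1,2,3,2,3)] by (simp add: ip_self)

lemma ip_diff_left:
  assumes "f \<in> square_integrable M" "g \<in> square_integrable M" "h \<in> square_integrable M"
  shows "ip M (\<lambda>x. f x - g x) h = ip M f h - ip M g h"
  using integrable_ip[OF assms(1,3)] integrable_ip[OF assms(2,3)]
  by (simp add: ip_def left_diff_distrib)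

lemma ip_cmult_left: "ip M (\<lambda>x. c * f x) g = c * ip M f g"
  by (simp add: ip_def mult.assoc)

lemma ip_cmult_right: "ip M f (\<lambda>x. c * g x) = cnj c * ip M f g"
  unfolding ip_def by (subst integral_mult_right_zero[symmetric]) (simp add: ac_simps)

lemma ip_commute: "ip M g f = cnj (ip M f g)"
  using Bochner_Integration.integral_cnj[of M "\<lambda>x. f x * cnj (g x)"] by (simp add: ip_def mult.commute)

lemma nsq_cmult: "nsq M (\<lambda>x. c * f x) = (cmod c)\<^sup>2 * nsq M f"
  by (simp add: nsq_def norm_mult power_mult_distrib)

lemma nsq_minus_commute: "nsq M (\<lambda>x. f x - g x) = nsq M (\<lambda>x. g x - f x)"
  by (simp add: nsq_def norm_minus_commute)

section \<open>Quadratic expansion, norm inequalities and the parallelogram law\<close>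

lemma nsq_add:
  assumes "f \<in> square_integrable M" "g \<in> square_integrable M"
  shows "nsq M (\<lambda>x. f x + g x) = nsq M f + 2 * Re (ip M f g) + nsq M g"
proof -
  have eq: "(cmod (a + b))\<^sup>2 = (cmod a)\<^sup>2 + 2 * Re (a * cnj b) + (cmod b)\<^sup>2" for a b :: complex
    unfolding cmod_power2 by (simp add: power2_eq_square algebra_simps)
  have lin: "(\<integral>x. p x + 2 * q x + r x \<partial>M) = (\<integral>x. p x \<partial>M) + 2 * (\<integral>x. q x \<partial>M) + (\<integral>x. r x \<partial>M)"
    if "integrable M p" "integrable M q" "integrable M r" for p q r :: "'a \<Rightarrow> real"
    using that by simp
  show ?thesis
    unfolding nsq_def ip_def eq integral_Re[OF integrable_ip[OF assms], symmetric]
    by (intro lin integrable_Re integrable_ip square_integrableD assms)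
qed

text \<open>The quadratic polynomial t -> \<open>nsq\<close> of f + t g is nonnegative for real t.
  Real t yields only the real part of the inner product, which is the part occurring in the triangle
  inequality.\<close>

lemma ip_cauchy_schwarz:
  assumes f: "f \<in> square_integrable M" and g: "g \<in> square_integrable M"
  shows "\<bar>Re (ip M f g)\<bar> \<le> sqrt (nsq M f) * sqrt (nsq M g)"
proof -
  define a b c where "a = nsq M f" and "b = Re (ip M f g)" and "c = nsq M g"
  have quad: "0 \<le> a + 2 * t * b + t\<^sup>2 * c" for t :: real
  proof -
    have "0 \<le> nsq M (\<lambda>x. f x + of_real t * g x)" by (rule nsq_nonneg)
    then show ?thesis
      by (simp add: nsq_add[OF f square_integrable_cmult[OF g]] ip_cmult_right nsq_cmult a_def b_def c_def)
  qed
  have "b\<^sup>2 \<le> a * c"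
  proof (cases "c = 0")
    case True
    have "b = 0"
    proof (rule ccontr)
      assume "b \<noteq> 0"
      then show False
        \<comment> \<open>With c = 0 the polynomial is affine, and this t gives it the value
          -1.\<close>
        using quad[of "- (a + 1) / (2 * b)"] True by (simp add: field_simps)
    qed
    then show ?thesis using True by simp
  next
    case False
    then have "c > 0" using nsq_nonneg[of M g] by (simp add: c_def)
    then show ?thesis
      \<comment> \<open>The minimiser of the quadratic polynomial.\<close>
      using quad[of "- b / c"] by (simp add: field_simps power2_eq_square)
  qed
  then have "sqrt (b\<^sup>2) \<le> sqrt (a * c)" by (rule real_sqrt_le_mono)
  then show ?thesis
    by (simp add: real_sqrt_mult a_def b_def c_def)
qed

lemma nsq_triangle:
  assumes f: "f \<in> square_integrable M" and g: "g \<in> square_integrable M"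
  shows "sqrt (nsq M (\<lambda>x. f x + g x)) \<le> sqrt (nsq M f) + sqrt (nsq M g)"
proof (rule real_le_lsqrt)
  show "nsq M (\<lambda>x. f x + g x) \<le> (sqrt (nsq M f) + sqrt (nsq M g))\<^sup>2"
    using ip_cauchy_schwarz[OF f g]
    by (simp add: nsq_add[OF f g] power2_sum nsq_nonneg)
qed (auto simp: nsq_nonneg)

lemma nsq_triangle_diff:
  assumes "f \<in> square_integrable M" "g \<in> square_integrable M" "h \<in> square_integrable M"
  shows "sqrt (nsq M (\<lambda>x. f x - h x)) \<le> sqrt (nsq M (\<lambda>x. f x - g x)) + sqrt (nsq M (\<lambda>x. g x - h x))"
  using nsq_triangle[OF square_integrable_diff[OF assms(1,2)] square_integrable_diff[OF assms(2,3)]]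
  by simp

text \<open>The parallelogram law for f - u and f - v, whose sum is twice the distance vector from
  the midpoint of u and v. In this form it shows that minimising sequences are Cauchy.\<close>

lemma nsq_parallelogram:
  assumes "f \<in> square_integrable M" "u \<in> square_integrable M" "v \<in> square_integrable M"
  shows "nsq M (\<lambda>x. u x - v x) =
    2 * nsq M (\<lambda>x. f x - u x) + 2 * nsq M (\<lambda>x. f x - v x) - 4 * nsq M (\<lambda>x. f x - (1/2) * (u x + v x))"
proof -
  have eq: "(cmod (a - b))\<^sup>2 = 2 * (cmod (c - a))\<^sup>2 + 2 * (cmod (c - b))\<^sup>2 - 4 * (cmod (c - (1/2) * (a + b)))\<^sup>2"
    for a b c :: complex
    unfolding cmod_power2 by (simp add: power2_eq_square field_simps)
  have "(\<lambda>x. f x - (1/2) * (u x + v x)) \<in> square_integrable M"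
    using square_integrable_diff[OF assms(1) square_integrable_cmult[OF square_integrable_add[OF assms(2,3)]]] .
  moreover have lin: "(\<integral>x. 2 * p x + 2 * q x - 4 * r x \<partial>M) = 2 * (\<integral>x. p x \<partial>M) + 2 * (\<integral>x. q x \<partial>M) - 4 * (\<integral>x. r x \<partial>M)"
    if "integrable M p" "integrable M q" "integrable M r" for p q r :: "'a \<Rightarrow> real"
    using that by simp
  ultimately show ?thesis
    unfolding nsq_def
    by (subst lin[symmetric]) (intro square_integrableD square_integrable_diff assms
        square_integrable_cmult square_integrable_add Bochner_Integration.integral_cong refl eq)+
qed

lemma nn_integral_nsq:
  assumes "f \<in> square_integrable M"
  shows "(\<integral>\<^sup>+x. ennreal ((cmod (f x))\<^sup>2) \<partial>M) = ennreal (nsq M f)"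
  unfolding nsq_def using square_integrableD(2)[OF assms] by (intro nn_integral_eq_integral) auto

text \<open>Along a subsequence with increments \<open>d k\<close> satisfying \<open>nsq M (d k) \<le> (1/4) ^ k\<close>, the series
  of \<open>2 ^ k * (cmod (d k x))\<^sup>2\<close> converges almost everywhere, hence so does that of \<open>d k x\<close>; Fatou's
  lemma then identifies the limit.\<close>

lemma square_integrable_complete:
  fixes f :: "nat \<Rightarrow> 'a \<Rightarrow> complex"
  assumes si: "\<And>n. f n \<in> square_integrable M"
    and cauchy: "\<And>e. e > 0 \<Longrightarrow> \<exists>N. \<forall>m\<ge>N. \<forall>n\<ge>N. nsq M (\<lambda>x. f m x - f n x) < e"
  shows "\<exists>g\<in>square_integrable M. (\<lambda>n. nsq M (\<lambda>x. f n x - g x)) \<longlonglongrightarrow> 0"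
proof -
  note [measurable] = square_integrableD(1)[OF si]
  have "\<forall>k. \<exists>N. \<forall>m\<ge>N. \<forall>n\<ge>N. nsq M (\<lambda>x. f m x - f n x) < (1/4)^k"
    by (intro allI cauchy) simp
  then obtain N where N: "\<And>k m n. m \<ge> N k \<Longrightarrow> n \<ge> N k \<Longrightarrow> nsq M (\<lambda>x. f m x - f n x) < (1/4)^k"
    by metis
  \<comment> \<open>A sum of naturals dominates each of its terms, so \<open>r j\<close> is at least
    \<open>N k\<close> for all k up to j. \<open>r\<close> need not be strictly increasing.\<close>
  define r where "r k = (\<Sum>j\<le>k. N j)" for k
  have r_ge: "N k \<le> r j" if "k \<le> j" for k j
    unfolding r_def using that by (intro member_le_sum) auto
  define d where "d k x = f (r (Suc k)) x - f (r k) x" for k x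
  have d_si: "d k \<in> square_integrable M" for k
    unfolding d_def by (intro square_integrable_diff si)
  have d_meas [measurable]: "d k \<in> borel_measurable M" for k
    using square_integrableD(1)[OF d_si] .
  have d_small: "nsq M (d k) \<le> (1/4)^k" for k
    using N[OF r_ge r_ge, of k "Suc k" k] by (simp add: d_def[abs_def])
  have "(\<integral>\<^sup>+x. (\<Sum>k. ennreal (2^k * (cmod (d k x))\<^sup>2)) \<partial>M) = (\<Sum>k. \<integral>\<^sup>+x. ennreal (2^k * (cmod (d k x))\<^sup>2) \<partial>M)"
    by (rule nn_integral_suminf) measurable
  also have "\<dots> \<le> (\<Sum>k. ennreal ((1/2)^k))"
  proof (rule suminf_le)
    fix k
    have "(\<integral>\<^sup>+x. ennreal (2^k * (cmod (d k x))\<^sup>2) \<partial>M) = ennreal (2^k) * ennreal (nsq M (d k))"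
      by (simp add: ennreal_mult nn_integral_cmult nn_integral_nsq[OF d_si])
    also have "\<dots> \<le> ennreal (2^k) * ennreal ((1/4)^k)"
      by (intro mult_left_mono ennreal_leI d_small) simp
    also have "\<dots> = ennreal ((1/2)^k)"
      by (simp add: ennreal_mult[symmetric] power_mult_distrib[symmetric])
    finally show "(\<integral>\<^sup>+x. ennreal (2^k * (cmod (d k x))\<^sup>2) \<partial>M) \<le> ennreal ((1/2)^k)" .
  qed auto
  also have "\<dots> = ennreal (\<Sum>k. (1/2)^k)"
    by (rule suminf_ennreal2) (auto intro!: summable_geometric)
  also have "\<dots> < \<infinity>" by simp
  finally have "AE x in M. (\<Sum>k. ennreal (2^k * (cmod (d k x))\<^sup>2)) \<noteq> \<infinity>"
    by (intro nn_integral_noteq_infinite) auto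
  then have conv: "AE x in M. convergent (\<lambda>k. f (r k) x)"
  proof eventually_elim
    case (elim x)
    then have "summable (\<lambda>k. 2^k * (cmod (d k x))\<^sup>2)"
      by (intro summable_suminf_not_top) auto
    then have "summable (\<lambda>k. 2^k * (cmod (d k x))\<^sup>2 + (1/2)^k)"
      by (intro summable_add) (auto intro!: summable_geometric)
    then have "summable (\<lambda>k. d k x)"
    proof (rule summable_comparison_test'[where N = 0])
      fix k
      let ?d = "cmod (d k x)"
      \<comment> \<open>Either the increment is at most (1/2)^k, or 2^k times it exceeds 1 and its
        weighted square dominates it. The weight thus passes from squares to the increments
        themselves.\<close>
      show "?d \<le> 2^k * ?d\<^sup>2 + (1/2)^k"
      proof (cases "?d \<le> (1/2)^k")
        case True
        then show ?thesis by (simp add: add_increasing)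
      next
        case False
        then have "1 \<le> 2^k * ?d" by (simp add: power_divide field_simps)
        then have "1 * ?d \<le> (2^k * ?d) * ?d" by (intro mult_right_mono) auto
        then show ?thesis by (simp add: power2_eq_square add_increasing2)
      qed
    qed
    then have "convergent (\<lambda>n. \<Sum>k<n. d k x)"
      by (simp add: summable_iff_convergent)
    moreover have "(\<Sum>k<n. d k x) = f (r n) x - f (r 0) x" for n
      unfolding d_def by (rule sum_lessThan_telescope)
    ultimately have "convergent (\<lambda>n. (f (r n) x - f (r 0) x) + f (r 0) x)"
      by (intro convergent_add convergent_const) simp
    then show ?case by simp
  qed
  \<comment> \<open>Off the convergence set \<open>lim\<close> has an arbitrary value, but that set
    is null.\<close>
  define g where "g x = lim (\<lambda>k. f (r k) x)" for x
  have g_meas [measurable]: "g \<in> borel_measurable M"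
    unfolding g_def by (rule borel_measurable_lim_metric) measurable
  \<comment> \<open>Fatou runs along \<open>r\<close>, yet the bound holds for every n from
    \<open>N k\<close> on, so the full sequence converges and not just the subsequence.\<close>
  have fatou: "(\<integral>\<^sup>+x. ennreal ((cmod (f n x - g x))\<^sup>2) \<partial>M) \<le> ennreal ((1/4)^k)" if "n \<ge> N k" for n k
  proof -
    have "(\<integral>\<^sup>+x. ennreal ((cmod (f n x - g x))\<^sup>2) \<partial>M)
        = (\<integral>\<^sup>+x. liminf (\<lambda>j. ennreal ((cmod (f n x - f (r j) x))\<^sup>2)) \<partial>M)"
    proof (rule nn_integral_cong_AE)
      show "AE x in M. ennreal ((cmod (f n x - g x))\<^sup>2) = liminf (\<lambda>j. ennreal ((cmod (f n x - f (r j) x))\<^sup>2))"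
        using conv
      proof eventually_elim
        case (elim x)
        then have "(\<lambda>j. f (r j) x) \<longlonglongrightarrow> g x"
          by (simp add: g_def convergent_LIMSEQ_iff)
        then have "(\<lambda>j. ennreal ((cmod (f n x - f (r j) x))\<^sup>2)) \<longlonglongrightarrow> ennreal ((cmod (f n x - g x))\<^sup>2)"
          by (intro tendsto_intros)
        then show ?case by (intro lim_imp_Liminf[symmetric]) auto
      qed
    qed
    also have "\<dots> \<le> liminf (\<lambda>j. \<integral>\<^sup>+x. ennreal ((cmod (f n x - f (r j) x))\<^sup>2) \<partial>M)"
      by (rule nn_integral_liminf) measurable
    also have "\<dots> \<le> liminf (\<lambda>j. ennreal ((1/4)^k))"
    proof (rule Liminf_mono)
      show "\<forall>\<^sub>F j in sequentially. (\<integral>\<^sup>+x. ennreal ((cmod (f n x - f (r j) x))\<^sup>2) \<partial>M) \<le> ennreal ((1/4)^k)"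
        using eventually_ge_at_top[of k]
      proof eventually_elim
        case (elim j)
        show ?case
          unfolding nn_integral_nsq[OF square_integrable_diff[OF si si]]
          by (intro ennreal_leI less_imp_le N that r_ge elim)
      qed
    qed
    also have "\<dots> = ennreal ((1/4)^k)" by (simp add: Liminf_const)
    finally show ?thesis .
  qed
  \<comment> \<open>The case k = 0 bounds the integral by 1; with \<open>f (N 0)\<close> this makes
    \<open>g\<close> square-integrable.\<close>
  have diff_si: "(\<lambda>x. f (N 0) x - g x) \<in> square_integrable M"
    unfolding square_integrable_def using fatou[of 0 "N 0"]
    by (auto intro!: integrableI_bounded simp: le_less_trans[OF _ ennreal_one_less_top])
  have g_si: "g \<in> square_integrable M"
    using square_integrable_diff[OF si[of "N 0"] diff_si] by simp
  have le: "nsq M (\<lambda>x. f n x - g x) \<le> (1/4)^k" if "n \<ge> N k" for n k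
    unfolding nsq_def by (rule integral_real_bounded) (use fatou[OF that] in auto)
  have "(\<lambda>n. nsq M (\<lambda>x. f n x - g x)) \<longlonglongrightarrow> 0"
  proof (rule LIMSEQ_I)
    fix e :: real assume "e > 0"
    then obtain k where "(1/4::real)^k < e"
      using real_arch_pow_inv[of e "1/4"] by auto
    then show "\<exists>n0. \<forall>n\<ge>n0. norm (nsq M (\<lambda>x. f n x - g x) - 0) < e"
      using le[of k] by (intro exI[of _ "N k"]) (auto simp: nsq_nonneg intro: le_less_trans)
  qed
  with g_si show ?thesis by blast
qed

text \<open>The projection is a point of \<open>S\<close> at minimal distance from \<open>f\<close>:
  a minimising sequence converges by completeness, and a nonzero inner product of the residual with
  some \<open>g\<close> would allow a closer point.\<close>

lemma orthogonal_projection_exists: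
  assumes sub: "S \<subseteq> square_integrable M" and ne: "S \<noteq> {}"
    and add: "\<And>f g. f \<in> S \<Longrightarrow> g \<in> S \<Longrightarrow> (\<lambda>x. f x + g x) \<in> S"
    and scale: "\<And>c f. f \<in> S \<Longrightarrow> (\<lambda>x. c * f x) \<in> S"
    and closed: "\<And>u g. (\<And>n. u n \<in> S) \<Longrightarrow> g \<in> square_integrable M \<Longrightarrow>
      (\<lambda>n. nsq M (\<lambda>x. u n x - g x)) \<longlonglongrightarrow> 0 \<Longrightarrow> g \<in> S"
    and f: "f \<in> square_integrable M"
  shows "\<exists>p\<in>S. \<forall>g\<in>S. ip M (\<lambda>x. f x - p x) g = 0"
proof -
  have S_si: "g \<in> square_integrable M" if "g \<in> S" for g using sub that by auto
  define d where "d = (INF e\<in>S. nsq M (\<lambda>x. f x - e x))"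
  have bdd: "bdd_below ((\<lambda>e. nsq M (\<lambda>x. f x - e x)) ` S)"
    by (auto intro!: bdd_belowI[of _ 0] simp: nsq_nonneg)
  have d_le: "d \<le> nsq M (\<lambda>x. f x - e x)" if "e \<in> S" for e
    unfolding d_def by (rule cINF_lower[OF bdd that])
  have d_nonneg: "0 \<le> d"
    unfolding d_def by (rule cINF_greatest[OF ne]) (simp add: nsq_nonneg)
  have "\<exists>e\<in>S. nsq M (\<lambda>x. f x - e x) < d + inverse (real (Suc n))" for n
    using cINF_less_iff[OF ne bdd, of "d + inverse (real (Suc n))"] by (simp add: d_def)
  then obtain u where u: "\<And>n. u n \<in> S" "\<And>n. nsq M (\<lambda>x. f x - u n x) < d + inverse (real (Suc n))"
    by metis
  \<comment> \<open>The midpoint of \<open>u m\<close> and \<open>u n\<close> is in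
    \<open>S\<close>, so its squared distance to \<open>f\<close> is at least \<open>d\<close>; the
    terms 4d cancel and only the errors remain.\<close>
  have u_diff: "nsq M (\<lambda>x. u m x - u n x) < 2 * inverse (real (Suc m)) + 2 * inverse (real (Suc n))" for m n
    using nsq_parallelogram[OF f S_si[OF u(1)] S_si[OF u(1)], of m n] u(2)[of m] u(2)[of n]
      d_le[OF scale[OF add[OF u(1)[of m] u(1)[of n]], of "1/2"]] by linarith
  have "\<exists>N. \<forall>m\<ge>N. \<forall>n\<ge>N. nsq M (\<lambda>x. u m x - u n x) < e" if "e > 0" for e
  proof -
    obtain N where N: "inverse (real (Suc N)) < e / 4"
      using reals_Archimedean[of "e / 4"] \<open>e > 0\<close> by (metis divide_pos_pos zero_less_numeral)
    have small: "inverse (real (Suc n)) < e / 4" if "n \<ge> N" for n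
      using that by (intro le_less_trans[OF _ N]) (simp add: field_simps)
    then have "nsq M (\<lambda>x. u m x - u n x) < e" if "m \<ge> N" "n \<ge> N" for m n
      using u_diff[of m n] that(1)[THEN small] that(2)[THEN small] by linarith
    then show ?thesis by blast
  qed
  from square_integrable_complete[OF S_si[OF u(1)] this]
  obtain p where p: "p \<in> square_integrable M" "(\<lambda>n. nsq M (\<lambda>x. u n x - p x)) \<longlonglongrightarrow> 0"
    by blast
  have pS: "p \<in> S" by (rule closed[OF u(1) p])
  have min: "nsq M (\<lambda>x. f x - p x) \<le> d"
  proof -
    \<comment> \<open>The limit is taken on square roots because the triangle inequality holds for
      the norm, not for \<open>nsq\<close>.\<close>
    have "sqrt (nsq M (\<lambda>x. f x - p x)) \<le> sqrt d"
    proof (rule LIMSEQ_le_const)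
      have "(\<lambda>n. sqrt (d + inverse (real (Suc n))) + sqrt (nsq M (\<lambda>x. u n x - p x))) \<longlonglongrightarrow> sqrt (d + 0) + sqrt 0"
        by (intro tendsto_intros p(2) LIMSEQ_inverse_real_of_nat)
      then show "(\<lambda>n. sqrt (d + inverse (real (Suc n))) + sqrt (nsq M (\<lambda>x. u n x - p x))) \<longlonglongrightarrow> sqrt d"
        by simp
      show "\<exists>N. \<forall>n\<ge>N. sqrt (nsq M (\<lambda>x. f x - p x)) \<le> sqrt (d + inverse (real (Suc n))) + sqrt (nsq M (\<lambda>x. u n x - p x))"
        using nsq_triangle_diff[OF f S_si[OF u(1)] p(1)] u(2)
        by (meson add_mono order_refl order_trans real_sqrt_le_mono less_imp_le)
    qed
    then show ?thesis by simp
  qed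
  have "ip M (\<lambda>x. f x - p x) g = 0" if g: "g \<in> S" for g
  proof (rule ccontr)
    define z where "z = ip M (\<lambda>x. f x - p x) g"
    define c where "c = nsq M g"
    assume "ip M (\<lambda>x. f x - p x) g \<noteq> 0"
    then have z: "cmod z > 0" by (simp add: z_def)
    have c: "c \<ge> 0" by (simp add: c_def nsq_nonneg)
    \<comment> \<open>Moving from p by s z g changes the squared distance by |z|^2 (s^2 c - 2 s).
      This s makes s c < 1, so the change is negative, also when c = 0.\<close>
    define s where "s = 1 / (1 + c)"
    have s: "s > 0" using c by (simp add: s_def)
    have fp: "(\<lambda>x. f x - p x) \<in> square_integrable M" by (rule square_integrable_diff[OF f p(1)])
    let ?t = "of_real s * z"
    have "(\<lambda>x. p x + ?t * g x) \<in> S" by (intro add scale pS g)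
    from d_le[OF this] have "nsq M (\<lambda>x. f x - p x) \<le> nsq M (\<lambda>x. (f x - p x) + (- ?t) * g x)"
      using min by (simp add: algebra_simps)
    also have "\<dots> = nsq M (\<lambda>x. f x - p x) + 2 * Re (cnj (- ?t) * z) + (cmod ?t)\<^sup>2 * c"
      unfolding nsq_add[OF fp square_integrable_cmult[OF S_si[OF g]]] ip_cmult_right nsq_cmult
      by (simp add: z_def c_def)
    also have "Re (cnj (- ?t) * z) = - s * (cmod z)\<^sup>2"
      unfolding cmod_power2 by (simp add: power2_eq_square algebra_simps)
    also have "(cmod ?t)\<^sup>2 = s\<^sup>2 * (cmod z)\<^sup>2"
      using s by (simp add: norm_mult power_mult_distrib)
    finally have "2 * s * (cmod z)\<^sup>2 \<le> s * (s * c) * (cmod z)\<^sup>2"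
      by (simp add: power2_eq_square algebra_simps)
    then have "2 \<le> s * c" using s z by (simp add: mult.assoc) 
    moreover have "s * c < 1" using c by (simp add: s_def field_simps)
    ultimately show False by simp
  qed
  with pS show ?thesis by blast
qed

section \<open>The space of square-integrable classes\<close>

lemma equiv_ae_rel: "equiv (square_integrable M) (ae_rel M)"
proof (rule equivI)
  show "ae_rel M \<subseteq> square_integrable M \<times> square_integrable M" by (auto simp: ae_rel_def)
  show "refl_on (square_integrable M) (ae_rel M)" by (auto simp: refl_on_def ae_rel_def)
  show "sym (ae_rel M)" by (auto simp: sym_def ae_rel_def)
  show "trans (ae_rel M)"
    unfolding trans_def ae_rel_def by (auto elim: eventually_elim2)
qed

lemma L2_cls_in_L2: "f \<in> square_integrable M \<Longrightarrow> L2_cls M f \<in> L2 M"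
  by (simp add: L2_cls_def L2_def quotientI)

lemma L2_cls_eq_iff:
  assumes "f \<in> square_integrable M" "g \<in> square_integrable M"
  shows "L2_cls M f = L2_cls M g \<longleftrightarrow> (AE x in M. f x = g x)"
  using eq_equiv_class_iff[OF equiv_ae_rel assms] assms by (simp add: L2_cls_def ae_rel_def)

lemma L2_rep_in: "F \<in> L2 M \<Longrightarrow> L2_rep F \<in> F"
  unfolding L2_def L2_rep_def
  by (drule in_quotient_imp_non_empty[OF equiv_ae_rel]) (simp add: some_in_eq)

lemma L2_rep_square_integrable: "F \<in> L2 M \<Longrightarrow> L2_rep F \<in> square_integrable M"
  using L2_rep_in[of F M] in_quotient_imp_subset[OF equiv_ae_rel] by (auto simp: L2_def)

lemma L2_cls_rep: "F \<in> L2 M \<Longrightarrow> L2_cls M (L2_rep F) = F"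
  using L2_rep_in[of F M] unfolding L2_def L2_cls_def
  by (auto elim!: quotientE dest: equiv_class_eq[OF equiv_ae_rel])

text \<open>The representative picked by \<open>L2_rep\<close> is unknown but stays in the class;
  this almost-everywhere equality is what makes the class operations computable on
  functions.\<close>

lemma L2_rep_cls:
  assumes "f \<in> square_integrable M"
  shows "AE x in M. L2_rep (L2_cls M f) x = f x"
  using L2_cls_eq_iff[OF L2_rep_square_integrable[OF L2_cls_in_L2[OF assms]] assms]
    L2_cls_rep[OF L2_cls_in_L2[OF assms]] by simp

lemma L2_inner_cls:
  assumes "f \<in> square_integrable M" "g \<in> square_integrable M"
  shows "L2_inner M (L2_cls M f) (L2_cls M g) = ip M f g"
  unfolding L2_inner_def ip_def[symmetric]
  by (intro ip_cong_AE L2_rep_cls L2_rep_square_integrable L2_cls_in_L2 assms)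

lemma L2_dist_cls:
  assumes "f \<in> square_integrable M" "g \<in> square_integrable M"
  shows "L2_dist M (L2_cls M f) (L2_cls M g) = sqrt (nsq M (\<lambda>x. f x - g x))"
proof -
  have "AE x in M. L2_rep (L2_cls M f) x - L2_rep (L2_cls M g) x = f x - g x"
    using L2_rep_cls[OF assms(1)] L2_rep_cls[OF assms(2)] by eventually_elim simp
  then show ?thesis
    unfolding L2_dist_def nsq_def[symmetric]
    by (intro arg_cong[where f = sqrt] nsq_cong_AE square_integrable_diff
        L2_rep_square_integrable L2_cls_in_L2 assms)
qed

lemma L2_add_cls:
  assumes "f \<in> square_integrable M" "g \<in> square_integrable M"
  shows "L2_add M (L2_cls M f) (L2_cls M g) = L2_cls M (\<lambda>x. f x + g x)"
  unfolding L2_add_def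
proof (subst L2_cls_eq_iff)
  show "AE x in M. L2_rep (L2_cls M f) x + L2_rep (L2_cls M g) x = f x + g x"
    using L2_rep_cls[OF assms(1)] L2_rep_cls[OF assms(2)] by eventually_elim simp
qed (intro square_integrable_add L2_rep_square_integrable L2_cls_in_L2 assms)+

lemma L2_diff_cls:
  assumes "f \<in> square_integrable M" "g \<in> square_integrable M"
  shows "L2_diff M (L2_cls M f) (L2_cls M g) = L2_cls M (\<lambda>x. f x - g x)"
  unfolding L2_diff_def
proof (subst L2_cls_eq_iff)
  show "AE x in M. L2_rep (L2_cls M f) x - L2_rep (L2_cls M g) x = f x - g x"
    using L2_rep_cls[OF assms(1)] L2_rep_cls[OF assms(2)] by eventually_elim simp
qed (intro square_integrable_diff L2_rep_square_integrable L2_cls_in_L2 assms)+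

lemma L2_scale_cls:
  assumes "f \<in> square_integrable M"
  shows "L2_scale M c (L2_cls M f) = L2_cls M (\<lambda>x. c * f x)"
  unfolding L2_scale_def
proof (subst L2_cls_eq_iff)
  show "AE x in M. c * L2_rep (L2_cls M f) x = c * f x"
    using L2_rep_cls[OF assms] by eventually_elim simp
qed (intro square_integrable_cmult L2_rep_square_integrable L2_cls_in_L2 assms)+

lemma L2_mult_cls:
  assumes f: "f \<in> square_integrable M" and s: "s \<in> borel_measurable M" "\<And>x. \<bar>s x\<bar> \<le> C"
  shows "L2_mult M s (L2_cls M f) = L2_cls M (\<lambda>x. complex_of_real (s x) * f x)"
  unfolding L2_mult_def
proof (subst L2_cls_eq_iff)
  have m: "(\<lambda>x. complex_of_real (s x)) \<in> borel_measurable M" using s(1) by measurable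
  show "(\<lambda>x. complex_of_real (s x) * f x) \<in> square_integrable M"
    "(\<lambda>x. complex_of_real (s x) * L2_rep (L2_cls M f) x) \<in> square_integrable M"
    by (rule square_integrable_bounded_mult[OF _ m, where C = C];
        simp add: s f L2_rep_square_integrable L2_cls_in_L2)+
  show "AE x in M. complex_of_real (s x) * L2_rep (L2_cls M f) x = complex_of_real (s x) * f x"
    using L2_rep_cls[OF f] by eventually_elim simp
qed

text \<open>Passing to classes upgrades the seminorm distance to a metric, which allows
  \<open>L2_closed\<close> to be read through balls.\<close>

lemma Metric_space_L2: "Metric_space (L2 M) (L2_dist M)"
proof
  note si = L2_rep_square_integrable
  have dist: "L2_dist M F G = sqrt (nsq M (\<lambda>x. L2_rep F x - L2_rep G x))" for F G
    by (simp add: L2_dist_def nsq_def)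
  show "0 \<le> L2_dist M F G" for F G by (simp add: dist nsq_nonneg)
  show "L2_dist M F G = L2_dist M G F" for F G
    unfolding dist by (subst nsq_minus_commute) (rule refl)
  show "L2_dist M F G = 0 \<longleftrightarrow> F = G" if "F \<in> L2 M" "G \<in> L2 M" for F G
    using L2_cls_eq_iff[OF si[OF that(1)] si[OF that(2)]] that
    by (simp add: dist nsq_eq_0_iff square_integrable_diff si L2_cls_rep)
  show "L2_dist M F H \<le> L2_dist M F G + L2_dist M G H"
    if "F \<in> L2 M" "G \<in> L2 M" "H \<in> L2 M" for F G H
    unfolding dist by (intro nsq_triangle_diff si that)
qed

text \<open>The representatives of the elements of \<open>E\<close>, so that one can compute with functions.\<close>

definition L2_fun :: "'a measure \<Rightarrow> 'a L2_class set \<Rightarrow> ('a \<Rightarrow> complex) set" where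
  "L2_fun M E = {f \<in> square_integrable M. L2_cls M f \<in> E}"

lemma L2_fun_add:
  "L2_subspace M E \<Longrightarrow> f \<in> L2_fun M E \<Longrightarrow> g \<in> L2_fun M E \<Longrightarrow> (\<lambda>x. f x + g x) \<in> L2_fun M E"
  by (auto simp: L2_fun_def L2_subspace_def square_integrable_add L2_add_cls[symmetric])

lemma L2_fun_cmult:
  "L2_subspace M E \<Longrightarrow> f \<in> L2_fun M E \<Longrightarrow> (\<lambda>x. c * f x) \<in> L2_fun M E"
  by (auto simp: L2_fun_def L2_subspace_def square_integrable_cmult L2_scale_cls[symmetric])

lemma L2_fun_rep:
  "L2_subspace M E \<Longrightarrow> F \<in> E \<Longrightarrow> L2_rep F \<in> L2_fun M E"
  by (auto simp: L2_fun_def L2_subspace_def L2_rep_square_integrable L2_cls_rep subset_iff)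

text \<open>Closedness is topological while the projection argument needs limits of sequences: a
  class outside \<open>E\<close> has a ball disjoint from \<open>E\<close>, which late members of
  the sequence would enter.\<close>

lemma L2_fun_closed:
  assumes E: "L2_closed M E" and u: "\<And>n. u n \<in> L2_fun M E" and g: "g \<in> square_integrable M"
    and lim: "(\<lambda>n. nsq M (\<lambda>x. u n x - g x)) \<longlonglongrightarrow> 0"
  shows "g \<in> L2_fun M E"
proof (rule ccontr)
  assume "g \<notin> L2_fun M E"
  then have "L2_cls M g \<in> L2 M - E"
    using g by (simp add: L2_fun_def L2_cls_in_L2)
  then obtain r where r: "r > 0" "disjnt E (Metric_space.mball (L2 M) (L2_dist M) (L2_cls M g) r)"
    using E unfolding L2_closed_def Metric_space.closedin_metric[OF Metric_space_L2] by blast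
  have "(\<lambda>n. sqrt (nsq M (\<lambda>x. u n x - g x))) \<longlonglongrightarrow> sqrt 0"
    by (intro tendsto_intros lim)
  then have "\<forall>\<^sub>F n in sequentially. sqrt (nsq M (\<lambda>x. u n x - g x)) < r"
    using r(1) by (intro order_tendstoD(2)) auto
  then obtain n where n: "sqrt (nsq M (\<lambda>x. u n x - g x)) < r"
    by (auto simp: eventually_sequentially)
  have un: "u n \<in> square_integrable M" "L2_cls M (u n) \<in> E"
    using u[of n] by (auto simp: L2_fun_def)
  have "L2_cls M (u n) \<in> Metric_space.mball (L2 M) (L2_dist M) (L2_cls M g) r"
    using n un g by (simp add: Metric_space.in_mball[OF Metric_space_L2] L2_cls_in_L2 L2_dist_cls nsq_minus_commute[of M g])
  with r(2) un(2) show False by (auto simp: disjnt_iff)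
qed

text \<open>The description \<open>THE\<close> in \<open>L2_proj\<close> needs existence, taken from
  the function-level projection, and uniqueness: the difference of two candidates lies in
  \<open>E\<close> and is orthogonal to itself.\<close>

lemma L2_proj_cls:
  assumes sub: "L2_subspace M E" and cl: "L2_closed M E" and f: "f \<in> square_integrable M"
  shows "\<exists>p\<in>L2_fun M E. L2_proj M E (L2_cls M f) = L2_cls M p \<and>
    (\<forall>g\<in>L2_fun M E. ip M (\<lambda>x. f x - p x) g = 0)"
proof -
  have EL2: "E \<subseteq> L2 M" using sub by (simp add: L2_subspace_def)
  have "\<exists>p\<in>L2_fun M E. \<forall>g\<in>L2_fun M E. ip M (\<lambda>x. f x - p x) g = 0"
  proof (rule orthogonal_projection_exists[OF _ _ _ _ _ f])
    show "L2_fun M E \<subseteq> square_integrable M" by (auto simp: L2_fun_def)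
    show "L2_fun M E \<noteq> {}" using sub L2_fun_rep[OF sub] by (auto simp: L2_subspace_def)
  qed (auto intro: L2_fun_add[OF sub] L2_fun_cmult[OF sub] L2_fun_closed[OF cl])
  then obtain p where p: "p \<in> L2_fun M E" "\<And>g. g \<in> L2_fun M E \<Longrightarrow> ip M (\<lambda>x. f x - p x) g = 0"
    by blast
  have psi: "p \<in> square_integrable M" "L2_cls M p \<in> E" using p(1) by (auto simp: L2_fun_def)
  have orth_iff: "(\<forall>G\<in>E. L2_inner M (L2_diff M (L2_cls M f) (L2_cls M q)) G = 0)
      \<longleftrightarrow> (\<forall>g\<in>L2_fun M E. ip M (\<lambda>x. f x - q x) g = 0)" if q: "q \<in> square_integrable M" for q
  proof -
    have eq: "L2_inner M (L2_diff M (L2_cls M f) (L2_cls M q)) (L2_cls M g) = ip M (\<lambda>x. f x - q x) g"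
      if "g \<in> square_integrable M" for g
      by (simp add: L2_diff_cls L2_inner_cls square_integrable_diff f q that)
    show ?thesis
    proof safe
      fix g assume "\<forall>G\<in>E. L2_inner M (L2_diff M (L2_cls M f) (L2_cls M q)) G = 0" "g \<in> L2_fun M E"
      then show "ip M (\<lambda>x. f x - q x) g = 0" using eq[of g] by (auto simp: L2_fun_def)
    next
      fix G assume *: "\<forall>g\<in>L2_fun M E. ip M (\<lambda>x. f x - q x) g = 0" "G \<in> E"
      have "G \<in> L2 M" using * EL2 by auto
      then show "L2_inner M (L2_diff M (L2_cls M f) (L2_cls M q)) G = 0"
        using eq[of "L2_rep G"] * L2_fun_rep[OF sub] by (simp add: L2_cls_rep L2_rep_square_integrable)
    qed
  qed
  have "L2_proj M E (L2_cls M f) = L2_cls M p"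
    unfolding L2_proj_def
  proof (rule the_equality)
    show "L2_cls M p \<in> E \<and> (\<forall>G\<in>E. L2_inner M (L2_diff M (L2_cls M f) (L2_cls M p)) G = 0)"
      using orth_iff[OF psi(1)] p psi by blast
  next
    fix Q assume Q: "Q \<in> E \<and> (\<forall>G\<in>E. L2_inner M (L2_diff M (L2_cls M f) Q) G = 0)"
    define q where "q = L2_rep Q"
    have QL2: "Q \<in> L2 M" using Q EL2 by auto
    have q: "q \<in> L2_fun M E" "q \<in> square_integrable M" "Q = L2_cls M q"
      using Q QL2 L2_fun_rep[OF sub, of Q] by (auto simp: q_def L2_cls_rep L2_rep_square_integrable)
    have q0: "ip M (\<lambda>x. f x - q x) g = 0" if "g \<in> L2_fun M E" for g
      using Q orth_iff[OF q(2)] that by (simp add: q(3))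
    define h where "h x = p x - q x" for x
    have h: "h \<in> L2_fun M E"
      using L2_fun_add[OF sub p(1) L2_fun_cmult[OF sub q(1), of "-1"]] by (simp add: h_def[abs_def])
    have hsi: "h \<in> square_integrable M" using h by (simp add: L2_fun_def)
    have "ip M h h = ip M (\<lambda>x. (f x - q x) - (f x - p x)) h"
      by (simp add: h_def[abs_def])
    also have "\<dots> = ip M (\<lambda>x. f x - q x) h - ip M (\<lambda>x. f x - p x) h"
      by (intro ip_diff_left square_integrable_diff f psi q hsi)
    also have "\<dots> = 0" by (simp add: p(2)[OF h] q0[OF h])
    finally have "nsq M h = 0" by (simp add: ip_self)
    then have "AE x in M. h x = 0" using nsq_eq_0_iff[OF hsi] by simp
    then have "AE x in M. q x = p x" by eventually_elim (simp add: h_def)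
    then show "Q = L2_cls M p" using L2_cls_eq_iff[OF q(2) psi(1)] q(3) by simp
  qed
  with p show ?thesis by blast
qed

text \<open>The residual of the projection is orthogonal to \<open>E\<close>, so against elements of
  \<open>E\<close> the compression has the same inner products as plain multiplication by
  \<open>s\<close>.\<close>

lemma compression_cls:
  assumes sub: "L2_subspace M E" and cl: "L2_closed M E"
    and s: "s \<in> borel_measurable M" "\<And>x. \<bar>s x\<bar> \<le> C" and f: "f \<in> L2_fun M E"
  shows "\<exists>p\<in>L2_fun M E. compression M E s (L2_cls M f) = L2_cls M p \<and>
    (\<forall>g\<in>L2_fun M E. ip M (\<lambda>x. complex_of_real (s x) * f x) g = ip M p g)"
proof -
  have fsi: "f \<in> square_integrable M" "L2_cls M f \<in> E" using f by (auto simp: L2_fun_def)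
  have si: "(\<lambda>x. complex_of_real (s x) * f x) \<in> square_integrable M"
    by (rule square_integrable_bounded_mult[OF fsi(1), where C = C]) (use s in \<open>auto\<close>)
  obtain p where p: "p \<in> L2_fun M E"
      "L2_proj M E (L2_cls M (\<lambda>x. complex_of_real (s x) * f x)) = L2_cls M p"
      "\<And>g. g \<in> L2_fun M E \<Longrightarrow> ip M (\<lambda>x. complex_of_real (s x) * f x - p x) g = 0"
    using L2_proj_cls[OF sub cl si] by blast
  have "ip M (\<lambda>x. complex_of_real (s x) * f x) g = ip M p g" if "g \<in> L2_fun M E" for g
    using p(3)[OF that] p(1) that by (simp add: ip_diff_left[OF si] L2_fun_def)
  moreover have "compression M E s (L2_cls M f) = L2_cls M p"
    using fsi p(2) by (simp add: compression_def L2_mult_cls[OF fsi(1) s])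
  ultimately show ?thesis using p(1) by blast
qed

lemma compression_funcset:
  assumes "L2_subspace M E" "L2_closed M E" "s \<in> borel_measurable M" "\<And>x. \<bar>s x\<bar> \<le> C"
  shows "compression M E s \<in> E \<rightarrow> E"
proof
  fix F assume F: "F \<in> E"
  then have "F \<in> L2 M" using assms(1) by (auto simp: L2_subspace_def)
  then show "compression M E s F \<in> E"
    using compression_cls[OF assms L2_fun_rep[OF assms(1) F]] by (auto simp: L2_cls_rep L2_fun_def)
qed

text \<open>Turns the operator equation into scalar identities between integrals, the form to which
  the fundamental lemma applies.\<close>

lemma compression_eq_scalar:
  assumes E: "L2_subspace M E" "L2_closed M E" and s: "s \<in> borel_measurable M" "\<And>x. \<bar>s x\<bar> \<le> C"
    and eq: "compression M E s = (\<lambda>F\<in>E. L2_scale M c F)"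
    and f: "f \<in> L2_fun M E" and g: "g \<in> L2_fun M E"
  shows "ip M (\<lambda>x. complex_of_real (s x) * f x) g = c * ip M f g"
proof -
  obtain p where p: "p \<in> L2_fun M E" "compression M E s (L2_cls M f) = L2_cls M p"
      "ip M (\<lambda>x. complex_of_real (s x) * f x) g = ip M p g"
    using compression_cls[OF E s f] g by blast
  have si: "f \<in> square_integrable M" "p \<in> square_integrable M" "g \<in> square_integrable M" "L2_cls M f \<in> E"
    using f p(1) g by (auto simp: L2_fun_def)
  have "L2_cls M p = L2_cls M (\<lambda>x. c * f x)"
    using p(2) si by (simp add: eq L2_scale_cls)
  then have "AE x in M. p x = c * f x"
    using L2_cls_eq_iff[OF si(2) square_integrable_cmult[OF si(1)]] by simp
  then have "ip M p g = ip M (\<lambda>x. c * f x) g"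
    by (intro ip_cong_AE) (auto intro: si square_integrable_cmult)
  then show ?thesis using p(3) by (simp add: ip_cmult_left)
qed

text \<open>One Gram-Schmidt step on the representatives of two independent classes.\<close>

lemma L2_dim_ge_2_orthogonal:
  assumes sub: "L2_subspace M E" and dim: "L2_dim_ge M 2 E"
  obtains f g where "f \<in> L2_fun M E" "g \<in> L2_fun M E" "nsq M f > 0" "nsq M g > 0" "ip M f g = 0"
proof -
  obtain F where F: "\<And>i. i < 2 \<Longrightarrow> F i \<in> E"
    "\<And>a. L2_lincomb M 2 a F = L2_zero M \<Longrightarrow> \<forall>i<2. a i = 0"
    using dim unfolding L2_dim_ge_def by (metis (no_types))
  define f h where "f = L2_rep (F 0)" and "h = L2_rep (F 1)"
  have fh: "f \<in> L2_fun M E" "h \<in> L2_fun M E"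
    unfolding f_def h_def by (intro L2_fun_rep[OF sub] F; simp)+
  then have si: "f \<in> square_integrable M" "h \<in> square_integrable M" by (auto simp: L2_fun_def)
  \<comment> \<open>Independence as positivity of the norm of every nontrivial combination; used
    with coefficients (1, 0) for \<open>f\<close> and (- c, 1) for the orthogonalised
    \<open>g\<close>.\<close>
  have pos: "nsq M (\<lambda>x. a * f x + b * h x) > 0" if "a \<noteq> 0 \<or> b \<noteq> 0" for a b
  proof (rule ccontr)
    have si': "(\<lambda>x. a * f x + b * h x) \<in> square_integrable M"
      by (intro square_integrable_add square_integrable_cmult si)
    assume "\<not> nsq M (\<lambda>x. a * f x + b * h x) > 0"
    then have "nsq M (\<lambda>x. a * f x + b * h x) = 0" using nsq_nonneg by (metis less_eq_real_def)
    then have "AE x in M. a * f x + b * h x = 0" using nsq_eq_0_iff[OF si'] by simp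
    then have "L2_cls M (\<lambda>x. a * f x + b * h x) = L2_zero M"
      unfolding L2_zero_def by (subst L2_cls_eq_iff[OF si']) auto
    then have "L2_lincomb M 2 (\<lambda>i. if i = 0 then a else b) F = L2_zero M"
      by (simp add: L2_lincomb_def numeral_2_eq_2 f_def h_def)
    from F(2)[OF this] that show False by (auto dest: spec[of _ "0::nat"] spec[of _ "1::nat"])
  qed
  have f0: "nsq M f > 0" using pos[of 1 0] by simp
  define c where "c = ip M h f / of_real (nsq M f)"
  define g where "g x = h x - c * f x" for x
  have g: "g \<in> L2_fun M E"
    using L2_fun_add[OF sub fh(2) L2_fun_cmult[OF sub fh(1), of "- c"]] by (simp add: g_def[abs_def])
  have "nsq M g > 0" using pos[of "- c" 1] by (simp add: g_def[abs_def])
  have "ip M g f = ip M h f - c * ip M f f"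
    unfolding g_def by (subst ip_diff_left) (auto intro: si square_integrable_cmult simp: ip_cmult_left)
  also have "\<dots> = 0" using f0 by (simp add: c_def ip_self)
  finally have "ip M f g = 0" using ip_commute[of M f g] by simp
  then show ?thesis using that fh(1) g f0 \<open>nsq M g > 0\<close> by blast
qed

theorem proposition2p3:
  fixes B :: "'b::euclidean_space set"
    and \<A> :: "('a::{t2_space, second_countable_topology}, 'b) chart set"
    and \<mu> :: "'a measure"
    and E :: "'a L2_class set"
  assumes "smooth_atlas B \<A>"
    and "positive_smooth_density B \<A> \<mu>"
    and "L2_subspace \<mu> E"
    and "L2_closed \<mu> E"
    and "L2_dim_ge \<mu> 2 E"
  shows "\<exists>\<sigma>\<in>Cc_infinity_interior B \<A>.
           compression \<mu> E \<sigma> \<in> E \<rightarrow> E \<and>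
           (\<forall>c::real. compression \<mu> E \<sigma> \<noteq> (\<lambda>F\<in>E. L2_scale \<mu> (complex_of_real c) F))"
proof (rule ccontr)
  assume contr: "\<not> ?thesis"
  note at = assms(1) and dens = assms(2) and E = assms(3,4)
  obtain f g where fg: "f \<in> L2_fun \<mu> E" "g \<in> L2_fun \<mu> E" "nsq \<mu> f > 0" "nsq \<mu> g > 0" "ip \<mu> f g = 0"
    using L2_dim_ge_2_orthogonal[OF assms(3,5)] by metis
  have si: "f \<in> square_integrable \<mu>" "g \<in> square_integrable \<mu>"
    using fg(1,2) by (simp_all add: L2_fun_def)
  \<comment> \<open>One scalar must serve all pairs u, v for a given \<open>\<sigma>\<close>, hence
    the order of quantifiers. Integrability is carried along because the second integrand is split
    into two integrals.\<close>
  have test: "\<exists>c. \<forall>u\<in>L2_fun \<mu> E. \<forall>v\<in>L2_fun \<mu> E.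
      integrable \<mu> (\<lambda>x. of_real (\<sigma> x) * (u x * cnj (v x))) \<and>
      (\<integral>x. of_real (\<sigma> x) * (u x * cnj (v x)) \<partial>\<mu>) = of_real c * ip \<mu> u v"
    if \<sigma>: "\<sigma> \<in> Cc_infinity_interior B \<A>" for \<sigma>
  proof -
    have meas: "\<sigma> \<in> borel_measurable \<mu>" by (rule Cc_infinity_interior_measurable[OF at dens \<sigma>])
    obtain C where C: "\<And>x. \<bar>\<sigma> x\<bar> \<le> C" using Cc_infinity_interior_bounded[OF at \<sigma>] by metis
    have "compression \<mu> E \<sigma> \<in> E \<rightarrow> E" by (rule compression_funcset[OF E meas C])
    then obtain c where c: "compression \<mu> E \<sigma> = (\<lambda>F\<in>E. L2_scale \<mu> (complex_of_real c) F)"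
      using contr \<sigma> by blast
    have "integrable \<mu> (\<lambda>x. of_real (\<sigma> x) * (u x * cnj (v x))) \<and>
      (\<integral>x. of_real (\<sigma> x) * (u x * cnj (v x)) \<partial>\<mu>) = of_real c * ip \<mu> u v"
      if uv: "u \<in> L2_fun \<mu> E" "v \<in> L2_fun \<mu> E" for u v
    proof
      have "u \<in> square_integrable \<mu>" "v \<in> square_integrable \<mu>"
        using uv by (simp_all add: L2_fun_def)
      then show "integrable \<mu> (\<lambda>x. of_real (\<sigma> x) * (u x * cnj (v x)))"
        using integrable_ip[of "\<lambda>x. of_real (\<sigma> x) * u x" \<mu> v]
          square_integrable_bounded_mult[of u \<mu> "\<lambda>x. of_real (\<sigma> x)" C] meas C
        by (simp add: mult.assoc)
      show "(\<integral>x. of_real (\<sigma> x) * (u x * cnj (v x)) \<partial>\<mu>) = of_real c * ip \<mu> u v"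
        using compression_eq_scalar[OF E meas C c uv] by (simp add: ip_def mult.assoc)
    qed
    then show ?thesis by blast
  qed
  have "AE x in \<mu>. f x * cnj (g x) = 0"
  proof (rule fundamental_lemma_complex[OF at dens integrable_ip[OF si]])
    fix \<sigma> assume "\<sigma> \<in> Cc_infinity_interior B \<A>"
    from test[OF this] show "(\<integral>x. of_real (\<sigma> x) * (f x * cnj (g x)) \<partial>\<mu>) = 0"
      using fg by auto
  qed
  moreover have "AE x in \<mu>. of_real (nsq \<mu> g) * (f x * cnj (f x)) - of_real (nsq \<mu> f) * (g x * cnj (g x)) = 0"
  proof (rule fundamental_lemma_complex[OF at dens])
    show "integrable \<mu> (\<lambda>x. of_real (nsq \<mu> g) * (f x * cnj (f x)) - of_real (nsq \<mu> f) * (g x * cnj (g x)))"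
      by (intro Bochner_Integration.integrable_diff integrable_mult_right integrable_ip si)
    fix \<sigma> assume "\<sigma> \<in> Cc_infinity_interior B \<A>"
    from test[OF this] obtain c where c: "\<forall>u\<in>L2_fun \<mu> E. \<forall>v\<in>L2_fun \<mu> E.
        integrable \<mu> (\<lambda>x. of_real (\<sigma> x) * (u x * cnj (v x))) \<and>
        (\<integral>x. of_real (\<sigma> x) * (u x * cnj (v x)) \<partial>\<mu>) = of_real c * ip \<mu> u v"
      by (rule exE)
    note cf = c[rule_format, OF fg(1) fg(1)] and cg = c[rule_format, OF fg(2) fg(2)]
    have "(\<integral>x. of_real (\<sigma> x) * (of_real (nsq \<mu> g) * (f x * cnj (f x)) - of_real (nsq \<mu> f) * (g x * cnj (g x))) \<partial>\<mu>)
      = (\<integral>x. of_real (nsq \<mu> g) * (of_real (\<sigma> x) * (f x * cnj (f x))) - of_real (nsq \<mu> f) * (of_real (\<sigma> x) * (g x * cnj (g x))) \<partial>\<mu>)"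
      by (intro Bochner_Integration.integral_cong refl) (simp only: right_diff_distrib mult.left_commute)
    also have "\<dots> = of_real (nsq \<mu> g) * (of_real c * ip \<mu> f f) - of_real (nsq \<mu> f) * (of_real c * ip \<mu> g g)"
      by (simp only: Bochner_Integration.integral_diff[OF
            integrable_mult_right[OF conjunct1[OF cf]] integrable_mult_right[OF conjunct1[OF cg]]]
          integral_mult_right_zero conjunct2[OF cf] conjunct2[OF cg])
    also have "\<dots> = 0" by (simp add: ip_self)
    finally show "(\<integral>x. of_real (\<sigma> x) * (of_real (nsq \<mu> g) * (f x * cnj (f x)) - of_real (nsq \<mu> f) * (g x * cnj (g x))) \<partial>\<mu>) = 0" .
  qed
  ultimately have "AE x in \<mu>. f x = 0"
  proof eventually_elim
    case (elim x)
    \<comment> \<open>If f is nonzero at x, then g vanishes there and the second identity becomes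
      \<open>nsq \<mu> g\<close> times |f|^2 = 0, contradicting the positivity of
      \<open>nsq \<mu> g\<close>.\<close>
    then show ?case using fg(4) by (cases "f x = 0") auto
  qed
  then show False using nsq_eq_0_iff[OF si(1)] fg(3) by simp
qed

end
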